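(* The following are all the non-trivial homogeneous Lorentzian Ricci solitons realized as three-dimensional unimodular Lie groups $G$ with a left-invariant Lorentzian metric (i.e. each of them is one, and each such soliton is of one of these forms), where $\{e_1,e_2,e_3\}$ is an orthonormal basis of the Lie algebra of $G$ of signature $(++-)$: (a) $G=E(1,1)$, with Lie algebra $(\mathfrak g_{II})$ and $\alpha=0\neq\beta$. The homogeneous Ricci soliton is steady and defined by the spacelike vector field $X=-\beta e_1$. (b) $G=O(1,2)$ or $SL(2,\mathbb{R})$, with Lie algebra $(\mathfrak g_{II})$ and $\alpha=\beta\neq0$. The homogeneous Ricci soliton is expanding and defined by the spacelike vector fields $X=-\frac12\beta e_1+\delta e_2+\delta e_3$, $\delta\in\mathbb{R}$. (c) $G=O(1,2)$ or $SL(2,\mathbb{R})$, with Lie algebra $(\mathfrak g_{III})$ and $\alpha\neq0$. The homogeneous Ricci soliton is expanding and defined by the spacelike vector field $X=\alpha e_1-\frac{1}{\sqrt2}e_2+\frac{1}{\sqrt2}e_3$. (d) $G=E(1,1)$, with Lie algebra $(\mathfrak g_{III})$ and $\alpha=0$. The homogeneous Ricci soliton is steady and defined by the null vector field $X=-\frac{1}{\sqrt2}e_2+\frac{1}{\sqrt2}e_3$. Here $$(\mathfrak g_{II}):\quad [e_1,e_2]=\tfrac12 e_2-(\beta-\tfrac12)e_3,\quad [e_1,e_3]=-(\beta+\tfrac12)e_2-\tfrac12e_3,\quad [e_2,e_3]=\alpha e_1,$$ $$(\mathfrak g_{III}):\quad [e_1,e_2]=-\tfrac{1}{\sqrt2}e_1-\alpha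 e_3,\quad [e_1,e_3]=-\tfrac{1}{\sqrt2}e_1-\alpha e_2,\quad [e_2,e_3]=\alpha e_1+\tfrac{1}{\sqrt2}e_2-\tfrac{1}{\sqrt2}e_3.$$
   Context: For a Lie group $G$ with left-invariant Lorentzian metric $g$, a homogeneous Ricci soliton is given by a left-invariant vector field $X$ (an element of the Lie algebra) and $\lambda\in\mathbb{R}$ with $\mathcal{L}_Xg+Ric=\lambda g$, where $\mathcal L_X$ is the Lie derivative and $Ric$ the Ricci tensor (sign convention: positive on round spheres); one says that the soliton is defined by $X$. It is shrinking, steady or expanding according to $\lambda>0$, $\lambda=0$, $\lambda<0$. It is non-trivial if $(G,g)$ is neither Einstein nor a product $\mathbb{R}\times N^2(c)$ with $N^2(c)$ of constant curvature. Signature $(++-)$ means $g(e_1,e_1)=g(e_2,e_2)=1=-g(e_3,e_3)$. A vector $X$ is spacelike if $g(X,X)>0$ and null if $X\neq0$ and $g(X,X)=0$. $E(1,1)$ is the group of rigid motions of the Minkowski plane. Identities such as "$G=E(1,1)$" or "$G=O(1,2)$ or $SL(2,\mathbb{R})$" identify $G$ up to local isomorphism, i.e. they identify the Lie algebra of $G$. *)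

theory Defs
  imports "HOL-Analysis.Analysis"
begin

text \<open>
  A Lie group with a left-invariant metric is represented by its Lie algebra of left-invariant
  vector fields: a finite-dimensional real vector space \<open>'a\<close> with a bracket \<open>br\<close> and a scalar
  product \<open>g\<close>. Any property of the Lie group up to local isometry is encoded in this pair.
  The class \<^class>\<open>euclidean_space\<close> only provides the finite-dimensional vector space; its own inner
  product is unrelated to \<open>g\<close> and is used only to write down the (basis-independent) trace.
\<close>

definition lin_trace :: "('a::euclidean_space \<Rightarrow> 'a) \<Rightarrow> real" where
  "lin_trace f = (\<Sum>b\<in>Basis. f b \<bullet> b)"

definition lie_bracket :: "('a::real_vector \<Rightarrow> 'a \<Rightarrow> 'a) \<Rightarrow> bool" where
  "lie_bracket br \<longleftrightarrow> bilinear br \<and> (\<forall>x. br x x = 0) \<and>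
     (\<forall>x y z. br x (br y z) + br y (br z x) + br z (br x y) = 0)"

text \<open>A connected Lie group has bi-invariant Haar measure iff all \<open>ad x\<close> are trace-free.\<close>

definition unimodular :: "('a::euclidean_space \<Rightarrow> 'a \<Rightarrow> 'a) \<Rightarrow> bool" where
  "unimodular br \<longleftrightarrow> (\<forall>x. lin_trace (br x) = 0)"

definition symmetric_form :: "('a::real_vector \<Rightarrow> 'a \<Rightarrow> real) \<Rightarrow> bool" where
  "symmetric_form g \<longleftrightarrow> bilinear g \<and> (\<forall>x y. g x y = g y x)"

definition orthonormal_basis_ppm ::
    "('a::real_vector \<Rightarrow> 'a \<Rightarrow> real) \<Rightarrow> 'a \<Rightarrow> 'a \<Rightarrow> 'a \<Rightarrow> bool" where
  "orthonormal_basis_ppm g e1 e2 e3 \<longleftrightarrow>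
     g e1 e1 = 1 \<and> g e2 e2 = 1 \<and> g e3 e3 = -1 \<and>
     g e1 e2 = 0 \<and> g e1 e3 = 0 \<and> g e2 e3 = 0 \<and>
     independent {e1, e2, e3} \<and> span {e1, e2, e3} = UNIV"

definition lorentzian :: "('a::real_vector \<Rightarrow> 'a \<Rightarrow> real) \<Rightarrow> bool" where
  "lorentzian g \<longleftrightarrow> symmetric_form g \<and> (\<exists>e1 e2 e3. orthonormal_basis_ppm g e1 e2 e3)"

definition spacelike :: "('a::real_vector \<Rightarrow> 'a \<Rightarrow> real) \<Rightarrow> 'a \<Rightarrow> bool" where
  "spacelike g X \<longleftrightarrow> g X X > 0"

definition null_vector :: "('a::real_vector \<Rightarrow> 'a \<Rightarrow> real) \<Rightarrow> 'a \<Rightarrow> bool" where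
  "null_vector g X \<longleftrightarrow> X \<noteq> 0 \<and> g X X = 0"

text \<open>
  On left-invariant fields the functions \<open>g y z\<close> are constant, so their derivatives
  disappear from metric compatibility and from the Lie derivative of the metric.
\<close>

definition levi_civita ::
    "('a::real_vector \<Rightarrow> 'a \<Rightarrow> 'a) \<Rightarrow> ('a \<Rightarrow> 'a \<Rightarrow> real) \<Rightarrow> 'a \<Rightarrow> 'a \<Rightarrow> 'a" where
  "levi_civita br g = (THE D. bilinear D \<and>
     (\<forall>x y. D x y - D y x = br x y) \<and>
     (\<forall>x y z. g (D x y) z + g y (D x z) = 0))"

definition curvature ::
    "('a::real_vector \<Rightarrow> 'a \<Rightarrow> 'a) \<Rightarrow> ('a \<Rightarrow> 'a \<Rightarrow> real) \<Rightarrow> 'a \<Rightarrow> 'a \<Rightarrow> 'a \<Rightarrow> 'a" where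
  "curvature br g x y z = (let D = levi_civita br g in
     D x (D y z) - D y (D x z) - D (br x y) z)"

definition ricci ::
    "('a::euclidean_space \<Rightarrow> 'a \<Rightarrow> 'a) \<Rightarrow> ('a \<Rightarrow> 'a \<Rightarrow> real) \<Rightarrow> 'a \<Rightarrow> 'a \<Rightarrow> real" where
  "ricci br g x y = lin_trace (\<lambda>z. curvature br g z x y)"

definition lie_derivative_metric ::
    "('a::real_vector \<Rightarrow> 'a \<Rightarrow> 'a) \<Rightarrow> ('a \<Rightarrow> 'a \<Rightarrow> real) \<Rightarrow> 'a \<Rightarrow> 'a \<Rightarrow> 'a \<Rightarrow> real" where
  "lie_derivative_metric br g X y z = - g (br X y) z - g y (br X z)"

definition ricci_soliton ::
    "('a::euclidean_space \<Rightarrow> 'a \<Rightarrow> 'a) \<Rightarrow> ('a \<Rightarrow> 'a \<Rightarrow> real) \<Rightarrow> 'a \<Rightarrow> real \<Rightarrow> bool" where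
  "ricci_soliton br g X l \<longleftrightarrow>
     (\<forall>y z. lie_derivative_metric br g X y z + ricci br g y z = l * g y z)"

definition steady_soliton ::
    "('a::euclidean_space \<Rightarrow> 'a \<Rightarrow> 'a) \<Rightarrow> ('a \<Rightarrow> 'a \<Rightarrow> real) \<Rightarrow> 'a \<Rightarrow> bool" where
  "steady_soliton br g X \<longleftrightarrow> ricci_soliton br g X 0"

definition expanding_soliton ::
    "('a::euclidean_space \<Rightarrow> 'a \<Rightarrow> 'a) \<Rightarrow> ('a \<Rightarrow> 'a \<Rightarrow> real) \<Rightarrow> 'a \<Rightarrow> bool" where
  "expanding_soliton br g X \<longleftrightarrow> (\<exists>l<0. ricci_soliton br g X l)"

definition einstein ::
    "('a::euclidean_space \<Rightarrow> 'a \<Rightarrow> 'a) \<Rightarrow> ('a \<Rightarrow> 'a \<Rightarrow> real) \<Rightarrow> bool" where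
  "einstein br g \<longleftrightarrow> (\<exists>c. \<forall>x y. ricci br g x y = c * g x y)"

definition parallel_curvature ::
    "('a::real_vector \<Rightarrow> 'a \<Rightarrow> 'a) \<Rightarrow> ('a \<Rightarrow> 'a \<Rightarrow> real) \<Rightarrow> bool" where
  "parallel_curvature br g \<longleftrightarrow> (let D = levi_civita br g; R = curvature br g in
     \<forall>w x y z. D w (R x y z) = R (D w x) y z + R x (D w y) z + R x y (D w z))"

definition perp_proj :: "('a::real_vector \<Rightarrow> 'a \<Rightarrow> real) \<Rightarrow> 'a \<Rightarrow> 'a \<Rightarrow> 'a" where
  "perp_proj g u x = x - (g x u / g u u) *\<^sub>R u"

text \<open>
  In dimension three, being locally isometric to a product \<open>\<real> \<times> N\<^sup>2(c)\<close>, where \<open>N\<^sup>2(c)\<close> has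
  constant curvature \<open>c\<close> and the line may be spacelike or timelike: \<open>u\<close> spans the tangent of the
  line factor, and at a point the curvature tensor is the pull-back of that of \<open>N\<^sup>2(c)\<close> under the
  projection to the second factor. The product is locally symmetric, so by Cartan's theorem a metric
  is locally isometric to it iff its curvature is parallel and has this form at one point.
  Thus there is no requirement that the splitting itself be left-invariant when \<open>c = 0\<close>.
\<close>

definition product_line_surface ::
    "('a::real_vector \<Rightarrow> 'a \<Rightarrow> 'a) \<Rightarrow> ('a \<Rightarrow> 'a \<Rightarrow> real) \<Rightarrow> bool" where
  "product_line_surface br g \<longleftrightarrow> parallel_curvature br g \<and>
     (\<exists>u c. g u u \<noteq> 0 \<and>
        (let p = perp_proj g u in
         \<forall>x y z. curvature br g x y z =
           c *\<^sub>R (g (p y) (p z) *\<^sub>R p x - g (p x) (p z) *\<^sub>R p y)))"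

definition nontrivial ::
    "('a::euclidean_space \<Rightarrow> 'a \<Rightarrow> 'a) \<Rightarrow> ('a \<Rightarrow> 'a \<Rightarrow> real) \<Rightarrow> bool" where
  "nontrivial br g \<longleftrightarrow> \<not> einstein br g \<and> \<not> product_line_surface br g"

definition algebra_II ::
    "('a::real_vector \<Rightarrow> 'a \<Rightarrow> 'a) \<Rightarrow> 'a \<Rightarrow> 'a \<Rightarrow> 'a \<Rightarrow> real \<Rightarrow> real \<Rightarrow> bool" where
  "algebra_II br e1 e2 e3 \<alpha> \<beta> \<longleftrightarrow>
     br e1 e2 = (1/2) *\<^sub>R e2 - (\<beta> - 1/2) *\<^sub>R e3 \<and>
     br e1 e3 = - ((\<beta> + 1/2) *\<^sub>R e2) - (1/2) *\<^sub>R e3 \<and>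
     br e2 e3 = \<alpha> *\<^sub>R e1"

definition algebra_III ::
    "('a::real_vector \<Rightarrow> 'a \<Rightarrow> 'a) \<Rightarrow> 'a \<Rightarrow> 'a \<Rightarrow> 'a \<Rightarrow> real \<Rightarrow> bool" where
  "algebra_III br e1 e2 e3 \<alpha> \<longleftrightarrow>
     br e1 e2 = - ((1 / sqrt 2) *\<^sub>R e1) - \<alpha> *\<^sub>R e3 \<and>
     br e1 e3 = - ((1 / sqrt 2) *\<^sub>R e1) - \<alpha> *\<^sub>R e2 \<and>
     br e2 e3 = \<alpha> *\<^sub>R e1 + (1 / sqrt 2) *\<^sub>R e2 - (1 / sqrt 2) *\<^sub>R e3"

definition iso_matrix_lie_algebra ::
    "('a::real_vector \<Rightarrow> 'a \<Rightarrow> 'a) \<Rightarrow> (real^'n^'n) set \<Rightarrow> bool" where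
  "iso_matrix_lie_algebra br S \<longleftrightarrow>
     (\<exists>\<phi>. linear \<phi> \<and> bij_betw \<phi> UNIV S \<and> (\<forall>x y. \<phi> (br x y) = \<phi> x ** \<phi> y - \<phi> y ** \<phi> x))"

text \<open>
  A rigid motion of the Minkowski plane \<open>v \<mapsto> B v + w\<close> is written as an affine block matrix with
  last row \<open>(0, 0, 1)\<close>; below, \<open>t\<close> generates the boosts and \<open>x, y\<close> the translations.
\<close>

definition e11 :: "(real^3^3) set" where
  "e11 = {vector [vector [0, t, x], vector [t, 0, y], vector [0, 0, 0]] | t x y. True}"

definition minkowski_form :: "real^3^3" where
  "minkowski_form = vector [vector [-1, 0, 0], vector [0, 1, 0], vector [0, 0, 1]]"

definition o12 :: "(real^3^3) set" where
  "o12 = {A. transpose A ** minkowski_form + minkowski_form ** A = 0}"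

definition sl2 :: "(real^2^2) set" where
  "sl2 = {A. trace A = 0}"

end

theory Submission
  imports Defs
begin

text \<open>
  In an orthonormal frame the bracket is \<open>A (cross x y)\<close>, where \<open>cross\<close> is the Lorentzian vector
  product, and unimodularity says that the operator \<open>A\<close> is self-adjoint. The Levi-Civita connection is
  then \<open>D x y = cross (M x) y\<close> with \<open>M = tr A / 2 - A\<close>, and the Ricci operator \<open>Q\<close> is a quadratic
  polynomial in \<open>A\<close>. With \<open>K = cross X\<close>, the soliton equation reads \<open>T = A K - K A\<close> for
  \<open>T = Q - l\<close>. Since \<open>T\<close> commutes with \<open>A\<close>, all powers of \<open>T\<close> are trace-free, so \<open>T\<close> is nilpotent.
  If the metric is not Einstein, then \<open>T \<noteq> 0\<close>, and the last nonzero power of \<open>T\<close> has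
  totally isotropic, hence one-dimensional, image; it is spanned by a null eigenvector of \<open>A\<close>. Null
  rotations and boosts fixing its direction bring \<open>A\<close> to one of the two non-diagonalisable normal forms
  \<open>II\<close> and \<open>III\<close>, where the soliton equation is solved by hand.
\<close>

section \<open>Traces and the Levi-Civita connection\<close>

lemma lin_trace_compose_commute:
  fixes f h :: "'a::euclidean_space \<Rightarrow> 'a"
  assumes "linear f" "linear h"
  shows "lin_trace (\<lambda>x. f (h x)) = lin_trace (\<lambda>x. h (f x))"
proof -
  have expand: "f' y \<bullet> b = (\<Sum>c\<in>Basis. (y \<bullet> c) * (f' c \<bullet> b))"
    if "linear f'" for f' :: "'a \<Rightarrow> 'a" and y b
  proof -
    have "f' y = f' (\<Sum>c\<in>Basis. (y \<bullet> c) *\<^sub>R c)"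
      by (simp add: euclidean_representation)
    also have "\<dots> = (\<Sum>c\<in>Basis. (y \<bullet> c) *\<^sub>R f' c)"
      using that by (simp add: linear_sum linear_scale)
    finally show ?thesis by (simp add: inner_sum_left)
  qed
  show ?thesis
    unfolding lin_trace_def expand[OF assms(1), of "h _"] expand[OF assms(2), of "f _"]
    by (subst sum.swap) (simp add: mult.commute)
qed

lemma lin_trace_add: "lin_trace (\<lambda>x. f x + h x) = lin_trace f + lin_trace h"
  by (simp add: lin_trace_def inner_add_left sum.distrib)

lemma lin_trace_diff: "lin_trace (\<lambda>x. f x - h x) = lin_trace f - lin_trace h"
  by (simp add: lin_trace_def inner_diff_left sum_subtractf)

lemma lin_trace_scale: "lin_trace (\<lambda>x. c *\<^sub>R f x) = c * lin_trace f"
  by (simp add: lin_trace_def sum_distrib_left)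

lemma lin_trace_rank_one:
  fixes h :: "'a::euclidean_space \<Rightarrow> real"
  assumes "linear h"
  shows "lin_trace (\<lambda>x. h x *\<^sub>R y) = h y"
proof -
  have "h y = h (\<Sum>b\<in>Basis. (y \<bullet> b) *\<^sub>R b)"
    by (simp add: euclidean_representation)
  also have "\<dots> = (\<Sum>b\<in>Basis. (y \<bullet> b) * h b)"
    using assms by (simp add: linear_sum linear_scale)
  finally show ?thesis by (simp add: lin_trace_def mult.commute)
qed

text \<open>Uniqueness for the \<open>THE\<close> in the definition, as in Koszul's argument: the
  difference \<open>S\<close> of two candidates is symmetric by torsion-freeness and skew in its
  last two slots by metricity, and alternating these symmetries three times each turns
  \<open>g (S x y) z\<close> into its own negative.\<close>

lemma levi_civita_eqI:
  fixes br :: "'a::real_vector \<Rightarrow> 'a \<Rightarrow> 'a"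
  assumes "symmetric_form g" and nondeg: "\<And>x. \<forall>z. g x z = 0 \<Longrightarrow> x = 0"
    and "bilinear D" and torsion: "\<And>x y. D x y - D y x = br x y"
    and metric: "\<And>x y z. g (D x y) z + g y (D x z) = 0"
  shows "levi_civita br g = D"
  unfolding levi_civita_def
proof (rule the_equality)
  fix D' assume D': "bilinear D' \<and> (\<forall>x y. D' x y - D' y x = br x y) \<and>
     (\<forall>x y z. g (D' x y) z + g y (D' x z) = 0)"
  have bil: "bilinear g" and sym: "\<And>x y. g x y = g y x"
    using assms(1) by (auto simp: symmetric_form_def)
  define S where "S x y = D' x y - D x y" for x y
  have S_sym: "S x y = S y x" for x y
    using torsion[of x y] D' unfolding S_def by (metis add_diff_cancel_left' diff_diff_eq2 diff_add_cancel)
  have S_skew: "g (S x y) z = - g (S x z) y" for x y z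
    using metric[of x y z] D' sym[of y] unfolding S_def
    by (simp add: bilinear_lsub[OF bil]) (smt (verit))
  have "g (S x y) z = 0" for x y z
    using S_skew[of x y z] S_skew[of y z x] S_skew[of z x y] S_sym by (smt (verit))
  then have "S x y = 0" for x y using nondeg by blast
  then show "D' = D" by (auto simp: S_def fun_eq_iff)
qed (use assms in auto)

text \<open>Pairing a vanishing combination with each of the three vectors kills its coefficients,
  and three independent vectors span in dimension three. New frames can therefore be recognised from
  their Gram matrix alone.\<close>

lemma orthonormal_basis_ppmI:
  fixes g :: "'a::euclidean_space \<Rightarrow> 'a \<Rightarrow> real"
  assumes "DIM('a) = 3" "symmetric_form g"
    and e: "g e1 e1 = 1" "g e2 e2 = 1" "g e3 e3 = -1" "g e1 e2 = 0" "g e1 e3 = 0" "g e2 e3 = 0"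
  shows "orthonormal_basis_ppm g e1 e2 e3"
proof -
  have bil: "bilinear g" and sym: "\<And>x y. g x y = g y x"
    using assms(2) by (auto simp: symmetric_form_def)
  have e': "g e2 e1 = 0" "g e3 e1 = 0" "g e3 e2 = 0" using e sym by metis+
  have dist: "e1 \<noteq> e2" "e1 \<noteq> e3" "e2 \<noteq> e3" using e by auto
  have "independent {e1, e2, e3}"
  proof (rule independent_if_scalars_zero)
    fix f x assume s: "(\<Sum>x\<in>{e1, e2, e3}. f x *\<^sub>R x) = 0" and x: "x \<in> {e1, e2, e3}"
    have s': "f e1 *\<^sub>R e1 + (f e2 *\<^sub>R e2 + f e3 *\<^sub>R e3) = 0"
      using s dist by simp
    have "g (f e1 *\<^sub>R e1 + (f e2 *\<^sub>R e2 + f e3 *\<^sub>R e3)) z =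
        f e1 * g e1 z + (f e2 * g e2 z + f e3 * g e3 z)" for z
      by (simp add: bilinear_ladd[OF bil] bilinear_lmul[OF bil])
    then have "f e1 * g e1 z + (f e2 * g e2 z + f e3 * g e3 z) = 0" for z
      by (simp add: s' bilinear_lzero[OF bil])
    from this[of e1] this[of e2] this[of e3] show "f x = 0"
      using x e e' by auto
  qed simp
  moreover from this have "span {e1, e2, e3} = UNIV"
    using assms(1) dist card_ge_dim_independent[of "{e1, e2, e3}" UNIV]
    by (auto simp: dim_UNIV)
  ultimately show ?thesis using e by (simp add: orthonormal_basis_ppm_def)
qed

section \<open>Lorentzian frames and the vector product\<close>

locale ppm_frame =
  fixes g :: "'a::euclidean_space \<Rightarrow> 'a \<Rightarrow> real" and e1 e2 e3 :: 'a
  assumes symmetric_g: "symmetric_form g"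
    and onb: "orthonormal_basis_ppm g e1 e2 e3"
begin

lemma bilinear_g: "bilinear g" and g_commute: "g x y = g y x"
  using symmetric_g by (auto simp: symmetric_form_def)

lemmas g_simps = bilinear_ladd[OF bilinear_g] bilinear_radd[OF bilinear_g]
  bilinear_lsub[OF bilinear_g] bilinear_rsub[OF bilinear_g]
  bilinear_lmul[OF bilinear_g] bilinear_rmul[OF bilinear_g]
  bilinear_lneg[OF bilinear_g] bilinear_rneg[OF bilinear_g]
  bilinear_lzero[OF bilinear_g] bilinear_rzero[OF bilinear_g]

lemma linear_g_left: "linear (\<lambda>x. g x y)"
  using bilinear_g by (simp add: bilinear_def)

lemma g_basis [simp]:
  "g e1 e1 = 1" "g e2 e2 = 1" "g e3 e3 = -1" "g e1 e2 = 0" "g e1 e3 = 0" "g e2 e3 = 0"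
  "g e2 e1 = 0" "g e3 e1 = 0" "g e3 e2 = 0"
  using onb g_commute by (metis orthonormal_basis_ppm_def)+

definition vec3 :: "real \<Rightarrow> real \<Rightarrow> real \<Rightarrow> 'a" where
  "vec3 a b c = a *\<^sub>R e1 + b *\<^sub>R e2 + c *\<^sub>R e3"

lemma g_vec3 [simp]: "g (vec3 a b c) (vec3 a' b' c') = a * a' + b * b' - c * c'"
  by (simp add: vec3_def g_simps)

lemma vec3_arith [simp]:
  "vec3 a b c + vec3 a' b' c' = vec3 (a + a') (b + b') (c + c')"
  "vec3 a b c - vec3 a' b' c' = vec3 (a - a') (b - b') (c - c')"
  "- vec3 a b c = vec3 (- a) (- b) (- c)"
  "k *\<^sub>R vec3 a b c = vec3 (k * a) (k * b) (k * c)"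
  by (simp_all add: vec3_def algebra_simps)

lemma vec3_basis: "vec3 1 0 0 = e1" "vec3 0 1 0 = e2" "vec3 0 0 1 = e3" "vec3 0 0 0 = 0"
  by (simp_all add: vec3_def)

lemma g_basis_vec3 [simp]:
  "g (vec3 a b c) e1 = a" "g (vec3 a b c) e2 = b" "g (vec3 a b c) e3 = - c"
  by (simp_all add: vec3_def g_simps)

lemma vec3_inject [simp]: "vec3 a b c = vec3 a' b' c' \<longleftrightarrow> a = a' \<and> b = b' \<and> c = c'"
  by (metis g_basis_vec3 neg_equal_iff_equal)

lemma vec3_cases: obtains a b c where "x = vec3 a b c"
proof -
  have "x \<in> span {e1, e2, e3}" using onb by (simp add: orthonormal_basis_ppm_def)
  then obtain a b c where "x = a *\<^sub>R e1 + b *\<^sub>R e2 + c *\<^sub>R e3"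
    by (auto simp: span_breakdown_eq algebra_simps)
  then show ?thesis using that by (simp add: vec3_def)
qed

lemma vec3_g: "vec3 (g x e1) (g x e2) (- g x e3) = x"
  by (rule vec3_cases[of x]) simp

lemma nondegenerate: "\<forall>z. g x z = 0 \<Longrightarrow> x = 0"
  using vec3_g[of x] by (metis vec3_basis(4) neg_equal_0_iff_equal)

lemma eq_if_g_eq: assumes "\<And>z. g x z = g y z" shows "x = y"
  using nondegenerate[of "x - y"] assms by (simp add: g_simps)

lemma linear_vec3:
  assumes "linear f"
  shows "f (vec3 a b c) = a *\<^sub>R f e1 + b *\<^sub>R f e2 + c *\<^sub>R f e3"
  using assms by (simp add: vec3_def linear_add linear_scale)

lemma linear_eqI_basis:
  assumes "linear f" "linear h" "f e1 = h e1" "f e2 = h e2" "f e3 = h e3"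
  shows "f x = h x"
  by (rule vec3_cases[of x]) (simp add: linear_vec3 assms)

text \<open>The trace was defined through an auxiliary inner product; writing \<open>f\<close> as a
  sum of the rank-one maps \<open>x \<mapsto> g x ei *\<^sub>R f ei\<close>, with a sign at
  \<open>e3\<close>, removes it.\<close>

lemma lin_trace_basis:
  assumes "linear f"
  shows "lin_trace f = g (f e1) e1 + g (f e2) e2 - g (f e3) e3"
proof -
  have "f x = g x e1 *\<^sub>R f e1 + g x e2 *\<^sub>R f e2 + g x e3 *\<^sub>R (- f e3)" for x
    by (subst vec3_g[of x, symmetric]) (simp add: linear_vec3[OF assms])
  then have "lin_trace f =
      lin_trace (\<lambda>x. g x e1 *\<^sub>R f e1 + g x e2 *\<^sub>R f e2 + g x e3 *\<^sub>R (- f e3))"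
    by (metis (no_types, lifting) ext)
  also have "\<dots> = g (f e1) e1 + g (f e2) e2 - g (f e3) e3"
    by (simp only: lin_trace_add lin_trace_rank_one[OF linear_g_left] g_simps)
  finally show ?thesis .
qed

lemma lin_trace_id: "lin_trace (\<lambda>x::'a. x) = 3"
  using lin_trace_basis[OF linear_id] by (simp add: id_def)

text \<open>The volume form with one index raised: \<open>g (cross x y) z\<close> is the determinant
  of the coordinates of \<open>x\<close>, \<open>y\<close>, \<open>z\<close>. The products with
  \<open>e3\<close> carry a sign because \<open>g x e3\<close> is minus the third
  coordinate.\<close>

definition cross :: "'a \<Rightarrow> 'a \<Rightarrow> 'a" where
  "cross x y = vec3 (g x e3 * g y e2 - g x e2 * g y e3) (g x e1 * g y e3 - g x e3 * g y e1)
     (g x e2 * g y e1 - g x e1 * g y e2)"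

lemma cross_vec3 [simp]: "cross (vec3 a b c) (vec3 a' b' c') =
    vec3 (b * c' - c * b') (c * a' - a * c') (b * a' - a * b')"
  by (simp add: cross_def)

lemma bilinear_cross: "bilinear cross"
  by (auto simp: bilinear_def cross_def g_simps algebra_simps intro!: linearI)

lemmas cross_simps = bilinear_ladd[OF bilinear_cross] bilinear_radd[OF bilinear_cross]
  bilinear_lsub[OF bilinear_cross] bilinear_rsub[OF bilinear_cross]
  bilinear_lmul[OF bilinear_cross] bilinear_rmul[OF bilinear_cross]
  bilinear_lneg[OF bilinear_cross] bilinear_rneg[OF bilinear_cross]

lemma linear_cross: "linear (cross x)" "linear (\<lambda>x. cross x y)"
  using bilinear_cross by (auto simp: bilinear_def)

lemma cross_skew: "cross y x = - cross x y"
  by (rule vec3_cases[of x], rule vec3_cases[of y]) simp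

lemma g_cross_skew: "g (cross x y) z = - g y (cross x z)"
  by (rule vec3_cases[of x], rule vec3_cases[of y], rule vec3_cases[of z])
     (simp add: algebra_simps)

text \<open>The sign is opposite to the Euclidean one, since the metric has an odd number of minus signs.\<close>

lemma cross_cross: "cross x (cross y z) = g x y *\<^sub>R z - g x z *\<^sub>R y"
  by (rule vec3_cases[of x], rule vec3_cases[of y], rule vec3_cases[of z])
     (simp add: algebra_simps)

text \<open>Self-adjointness makes the matrix \<open>g (A ei) ej\<close> symmetric, which leaves six
  parameters; raising the index back changes the sign of the last row.\<close>

lemma selfadjoint_vec3:
  assumes "linear A" "\<And>x y. g (A x) y = g x (A y)"
  obtains s11 s12 s13 s22 s23 s33 where
    "\<And>x y z. A (vec3 x y z) = vec3 (x * s11 + y * s12 + z * s13) (x * s12 + y * s22 + z * s23)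
      (- (x * s13) - y * s23 - z * s33)"
    "A e1 = vec3 s11 s12 (- s13)" "A e2 = vec3 s12 s22 (- s23)" "A e3 = vec3 s13 s23 (- s33)"
proof -
  have s: "g (A e2) e1 = g (A e1) e2" "g (A e3) e1 = g (A e1) e3" "g (A e3) e2 = g (A e2) e3"
    using assms(2) g_commute by metis+
  show ?thesis
  proof
    fix x y z
    have "A (vec3 x y z) = x *\<^sub>R vec3 (g (A e1) e1) (g (A e1) e2) (- g (A e1) e3) +
        y *\<^sub>R vec3 (g (A e1) e2) (g (A e2) e2) (- g (A e2) e3) +
        z *\<^sub>R vec3 (g (A e1) e3) (g (A e2) e3) (- g (A e3) e3)"
      using s vec3_g linear_vec3[OF assms(1)] by metis
    then show "A (vec3 x y z) =
        vec3 (x * g (A e1) e1 + y * g (A e1) e2 + z * g (A e1) e3)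
          (x * g (A e1) e2 + y * g (A e2) e2 + z * g (A e2) e3)
          (- (x * g (A e1) e3) - y * g (A e2) e3 - z * g (A e3) e3)"
      by simp
  qed (metis s vec3_g)+
qed

text \<open>Applying \<open>A\<close> to one argument of a determinant at a time and adding the
  three results multiplies it by the trace. The term with \<open>A\<close> on the third argument
  moves to \<open>cross x y\<close> by self-adjointness.\<close>

lemma cross_selfadjoint_sum:
  assumes "linear A" "\<And>x y. g (A x) y = g x (A y)"
  shows "cross (A x) y + cross x (A y) = lin_trace A *\<^sub>R cross x y - A (cross x y)"
proof -
  obtain s11 s12 s13 s22 s23 s33 where
    A: "\<And>x y z. A (vec3 x y z) = vec3 (x * s11 + y * s12 + z * s13) (x * s12 + y * s22 + z * s23)
      (- (x * s13) - y * s23 - z * s33)"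
    and Ae: "A e1 = vec3 s11 s12 (- s13)" "A e2 = vec3 s12 s22 (- s23)" "A e3 = vec3 s13 s23 (- s33)"
    using selfadjoint_vec3[OF assms] by blast
  show ?thesis
    unfolding lin_trace_basis[OF assms(1)]
    by (rule vec3_cases[of x], rule vec3_cases[of y])
       (simp add: A Ae algebra_simps)
qed

text \<open>The vector product of two images is the adjugate of \<open>A\<close> applied to
  \<open>cross x y\<close>, and Cayley-Hamilton writes the adjugate as a quadratic polynomial in
  \<open>A\<close>.\<close>

lemma cross_selfadjoint_both:
  assumes "linear A" "\<And>x y. g (A x) y = g x (A y)"
  shows "cross (A x) (A y) = A (A (cross x y)) - lin_trace A *\<^sub>R A (cross x y) +
    (((lin_trace A)\<^sup>2 - lin_trace (\<lambda>x. A (A x))) / 2) *\<^sub>R cross x y"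
proof -
  obtain s11 s12 s13 s22 s23 s33 where
    A: "\<And>x y z. A (vec3 x y z) = vec3 (x * s11 + y * s12 + z * s13) (x * s12 + y * s22 + z * s23)
      (- (x * s13) - y * s23 - z * s33)"
    and Ae: "A e1 = vec3 s11 s12 (- s13)" "A e2 = vec3 s12 s22 (- s23)" "A e3 = vec3 s13 s23 (- s33)"
    using selfadjoint_vec3[OF assms] by blast
  have lin2: "linear (\<lambda>x. A (A x))"
    using linear_compose[OF assms(1,1)] by (simp add: o_def)
  have t1: "lin_trace A = s11 + s22 - s33"
    by (simp add: lin_trace_basis[OF assms(1)] A Ae)
  have t2: "((lin_trace A)\<^sup>2 - lin_trace (\<lambda>x. A (A x))) / 2 =
      s11 * s22 - s11 * s33 - s22 * s33 - s12 * s12 + s13 * s13 + s23 * s23"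
    unfolding t1 lin_trace_basis[OF lin2]
    by (simp add: A Ae power2_eq_square field_simps)
  show ?thesis
    unfolding t2 unfolding t1
    by (rule vec3_cases[of x], rule vec3_cases[of y])
       (simp add: A algebra_simps)
qed

end

section \<open>Curvature of a unimodular Lie algebra\<close>

locale ppm_lie_algebra = ppm_frame +
  fixes br :: "'a \<Rightarrow> 'a \<Rightarrow> 'a"
  assumes bilinear_br: "bilinear br" and br_self: "br x x = 0"
begin

lemmas br_simps = bilinear_ladd[OF bilinear_br] bilinear_radd[OF bilinear_br]
  bilinear_lsub[OF bilinear_br] bilinear_rsub[OF bilinear_br]
  bilinear_lmul[OF bilinear_br] bilinear_rmul[OF bilinear_br]
  bilinear_lneg[OF bilinear_br] bilinear_rneg[OF bilinear_br]
  bilinear_lzero[OF bilinear_br] bilinear_rzero[OF bilinear_br]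

lemma br_skew: "br y x = - br x y"
proof -
  have "br x y + br y x = 0"
    using br_self[of "x + y"] br_self[of x] br_self[of y] by (simp add: br_simps add.commute)
  then show ?thesis by (simp add: eq_neg_iff_add_eq_0 add.commute)
qed

text \<open>The linear operator determined by \<open>br x y = A (cross x y)\<close>. The sign in
  \<open>cross e1 e2 = - e3\<close> is matched by \<open>g e3 e3 = -1\<close>.\<close>

definition struct_op :: "'a \<Rightarrow> 'a" ("A") where
  "A x = g x e1 *\<^sub>R br e2 e3 + g x e2 *\<^sub>R br e3 e1 + g x e3 *\<^sub>R br e1 e2"

lemma linear_A: "linear A"
  by (auto simp: struct_op_def g_simps algebra_simps intro!: linearI)

lemma linear_A2: "linear (\<lambda>x. A (A x))"
  using linear_compose[OF linear_A linear_A] by (simp add: o_def)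

lemmas A_simps = linear_add[OF linear_A] linear_diff[OF linear_A] linear_scale[OF linear_A]
  linear_neg[OF linear_A] linear_0[OF linear_A]

lemma A_basis: "A e1 = br e2 e3" "A e2 = - br e1 e3" "A e3 = - br e1 e2"
  by (simp_all add: struct_op_def br_skew[of e3])

lemma br_vec3: "br (vec3 a b c) (vec3 a' b' c') = (a * b' - b * a') *\<^sub>R br e1 e2 +
    (a * c' - c * a') *\<^sub>R br e1 e3 + (b * c' - c * b') *\<^sub>R br e2 e3"
  by (simp add: vec3_def br_simps br_self br_skew[of e1 e2] br_skew[of e2 e3] br_skew[of e1 e3]
      algebra_simps)

lemma br_eq_A_cross: "br x y = A (cross x y)"
  by (rule vec3_cases[of x], rule vec3_cases[of y])
     (simp add: br_vec3 linear_vec3[OF linear_A] A_basis algebra_simps)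

text \<open>The trace of \<open>br x\<close> is linear in \<open>x\<close>, and its three
  coefficients are the antisymmetric parts of the matrix \<open>g (A ei) ej\<close>.\<close>

lemma unimodular_iff_basis: "unimodular br \<longleftrightarrow>
    g (A e2) e3 = g (A e3) e2 \<and> g (A e3) e1 = g (A e1) e3 \<and> g (A e2) e1 = g (A e1) e2"
  (is "_ \<longleftrightarrow> ?R")
proof -
  have tr: "lin_trace (br (vec3 a b c)) = a * (g (A e2) e3 - g (A e3) e2) +
      b * (g (A e3) e1 - g (A e1) e3) + c * (g (A e2) e1 - g (A e1) e2)" for a b c
  proof -
    have "linear (br (vec3 a b c))" using bilinear_br by (simp add: bilinear_def)
    from lin_trace_basis[OF this] show ?thesis
      by (simp add: A_basis vec3_def br_simps br_self br_skew[of e2 e1] br_skew[of e3 e2]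
          br_skew[of e3 e1] g_simps algebra_simps)
  qed
  show ?thesis
  proof
    assume "unimodular br"
    then show ?R
      using tr[of 1 0 0] tr[of 0 1 0] tr[of 0 0 1] by (simp add: unimodular_def)
  next
    assume ?R
    then show "unimodular br"
      unfolding unimodular_def by (metis (no_types) tr vec3_cases mult_zero_right diff_self add.right_neutral)
  qed
qed

lemma selfadjoint_if_unimodular:
  assumes "unimodular br"
  shows "g (A x) y = g x (A y)"
proof -
  have "g (A e2) e3 = g (A e3) e2" "g (A e3) e1 = g (A e1) e3" "g (A e2) e1 = g (A e1) e2"
    using assms unimodular_iff_basis by auto
  moreover from this have "g e3 (A e2) = g (A e3) e2" "g e1 (A e3) = g (A e1) e3"
    "g e1 (A e2) = g (A e1) e2" "g e2 (A e3) = g (A e3) e2" "g e3 (A e1) = g (A e1) e3"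
    "g e2 (A e1) = g (A e1) e2"
    by (metis g_commute)+
  ultimately show ?thesis
    by (rule_tac vec3_cases[of x], rule_tac vec3_cases[of y])
       (simp add: linear_vec3[OF linear_A] vec3_def g_simps A_simps algebra_simps
        g_commute[of e1 "A e1"] g_commute[of e2 "A e2"] g_commute[of e3 "A e3"])
qed

end

locale ppm_unimodular = ppm_lie_algebra +
  assumes unimodular_br: "unimodular br"
begin

lemma selfadjoint_A: "g (A x) y = g x (A y)"
  using unimodular_br by (rule selfadjoint_if_unimodular)

text \<open>The Jacobi identity follows from self-adjointness of \<open>A\<close>: once the inner
  \<open>A\<close> is moved off the vector product, every term is a triple product, and the cyclic
  sum of their expansions cancels.\<close>

lemma lie_bracket_br: "lie_bracket br"
proof -
  have "br x (br y z) = A (lin_trace A *\<^sub>R cross x (cross y z)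
      - cross x (cross (A y) z) - cross x (cross y (A z)))" for x y z
  proof -
    have "A (cross y z) = lin_trace A *\<^sub>R cross y z - cross (A y) z - cross y (A z)"
      using cross_selfadjoint_sum[OF linear_A selfadjoint_A, of y z] by (simp add: algebra_simps)
    then show ?thesis by (simp add: br_eq_A_cross cross_simps)
  qed
  moreover have "g v (A u) = g u (A v)" for u v
    using selfadjoint_A g_commute by metis
  ultimately have "br x (br y z) + br y (br z x) + br z (br x y) = A 0" for x y z
    by (simp only: linear_add[OF linear_A, symmetric])
       (simp add: cross_cross selfadjoint_A g_commute[of y x] g_commute[of z x] g_commute[of z y]
         algebra_simps)
  then show ?thesis
    unfolding lie_bracket_def using bilinear_br br_self by (simp add: A_simps)
qed

definition half_op :: "'a \<Rightarrow> 'a" ("M") where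
  "M x = (lin_trace A / 2) *\<^sub>R x - A x"

lemma linear_M: "linear M"
  by (auto simp: half_op_def A_simps algebra_simps intro!: linearI)

lemma selfadjoint_M: "g (M x) y = g x (M y)"
  by (simp add: half_op_def g_simps selfadjoint_A)

lemma lin_trace_M: "lin_trace M = lin_trace A / 2"
  unfolding half_op_def[abs_def] by (simp add: lin_trace_diff lin_trace_scale lin_trace_id)

lemma lin_trace_M2: "lin_trace (\<lambda>x. M (M x)) = lin_trace (\<lambda>x. A (A x)) - (lin_trace A)\<^sup>2 / 4"
proof -
  have "M (M x) = ((lin_trace A)\<^sup>2 / 4) *\<^sub>R x - lin_trace A *\<^sub>R A x + A (A x)" for x
    by (simp add: half_op_def A_simps power2_eq_square algebra_simps flip: scaleR_left.add)
  then show ?thesis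
    by (simp add: lin_trace_add lin_trace_diff lin_trace_scale lin_trace_id power2_eq_square)
qed

text \<open>Each \<open>cross (M x)\<close> is skew, hence metric. The derivation identity turns the
  torsion condition into \<open>lin_trace M - M = A\<close>, and the multiple of the identity in
  \<open>M\<close> is the one that achieves this.\<close>

lemma levi_civita_br: "levi_civita br g = (\<lambda>x y. cross (M x) y)"
proof (rule levi_civita_eqI[OF symmetric_g nondegenerate])
  show "bilinear (\<lambda>x y. cross (M x) y)"
    by (auto simp: bilinear_def cross_simps linear_add[OF linear_M] linear_scale[OF linear_M]
      intro!: linearI)
  show "cross (M x) y - cross (M y) x = br x y" for x y
  proof -
    have "cross (M x) y - cross (M y) x = cross (M x) y + cross x (M y)"
      by (simp add: cross_skew[of "M y"])
    also have "\<dots> = lin_trace M *\<^sub>R cross x y - M (cross x y)"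
      by (rule cross_selfadjoint_sum[OF linear_M selfadjoint_M])
    also have "\<dots> = br x y" by (simp add: lin_trace_M half_op_def br_eq_A_cross)
    finally show ?thesis .
  qed
  show "g (cross (M x) y) z + g y (cross (M x) z) = 0" for x y z
    by (simp add: g_cross_skew)
qed

text \<open>The curvature operator on bivectors, with bivectors identified with vectors by
  \<open>cross\<close>.\<close>

definition curv_op :: "'a \<Rightarrow> 'a" ("P") where
  "P x = 2 *\<^sub>R A (A x) - lin_trace A *\<^sub>R A x
     + ((lin_trace A)\<^sup>2 / 4 - lin_trace (\<lambda>x. A (A x)) / 2) *\<^sub>R x"

lemma linear_P: "linear P"
  by (auto simp: curv_op_def A_simps algebra_simps intro!: linearI)

lemma cross_jacobi: "cross x (cross y z) - cross y (cross x z) = cross (cross x y) z"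
  by (simp add: cross_cross cross_skew[of "cross x y" z] g_commute[of x y] g_commute[of x z]
      g_commute[of y z])

text \<open>Since \<open>cross\<close> represents the vector product by commutators
  (\<open>cross_jacobi\<close>), the curvature is again a vector product with one vector. The
  adjugate formula for \<open>M\<close> makes that vector a polynomial in \<open>A\<close> applied
  to \<open>cross x y\<close>.\<close>

lemma curvature_br: "curvature br g x y z = cross (P (cross x y)) z"
proof -
  have "curvature br g x y z =
      cross (M x) (cross (M y) z) - cross (M y) (cross (M x) z) - cross (M (br x y)) z"
    by (simp add: curvature_def levi_civita_br)
  also have "\<dots> = cross (cross (M x) (M y) - M (br x y)) z"
    by (simp add: cross_jacobi cross_simps)
  also have "cross (M x) (M y) - M (br x y) = P (cross x y)"
  proof -
    have half: "lin_trace A *\<^sub>R v = (lin_trace A / 2) *\<^sub>R v + (lin_trace A / 2) *\<^sub>R v" for v :: 'a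
      by (simp flip: scaleR_left_distrib)
    have coeff: "((lin_trace M)\<^sup>2 - lin_trace (\<lambda>x. M (M x))) / 2 =
        (lin_trace A)\<^sup>2 / 4 - lin_trace (\<lambda>x. A (A x)) / 2"
      by (simp add: lin_trace_M lin_trace_M2 power2_eq_square field_simps)
    show ?thesis
      unfolding cross_selfadjoint_both[OF linear_M selfadjoint_M] coeff unfolding lin_trace_M
      by (simp add: br_eq_A_cross half_op_def curv_op_def A_simps half scaleR_2 algebra_simps
          power2_eq_square)
  qed
  finally show ?thesis .
qed

text \<open>This is \<open>lin_trace P\<close> times the identity, minus \<open>P\<close>.\<close>

definition ricci_op :: "'a \<Rightarrow> 'a" ("Q") where
  "Q x = lin_trace A *\<^sub>R A x - 2 *\<^sub>R A (A x)
     + (lin_trace (\<lambda>x. A (A x)) - (lin_trace A)\<^sup>2 / 2) *\<^sub>R x"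

lemma lin_trace_P: "lin_trace P = lin_trace (\<lambda>x. A (A x)) / 2 - (lin_trace A)\<^sup>2 / 4"
  unfolding curv_op_def[abs_def]
  by (simp add: lin_trace_add lin_trace_diff lin_trace_scale lin_trace_id power2_eq_square)

text \<open>Cyclicity of the trace brings the two vector products together; their triple product
  expansion leaves a multiple of \<open>P\<close> and a rank-one map, whose traces are
  known.\<close>

lemma ricci_br: "ricci br g x y = g (Q x) y"
proof -
  have lin: "linear (\<lambda>z. cross z y)" "linear (\<lambda>z. P (cross z x))"
    using linear_cross(2) linear_compose[OF linear_cross(2) linear_P] by (auto simp: o_def)
  have "ricci br g x y = lin_trace (\<lambda>z. cross (P (cross z x)) y)"
    by (simp add: ricci_def curvature_br)
  also have "\<dots> = lin_trace (\<lambda>z. P (cross (cross z y) x))"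
    by (rule lin_trace_compose_commute[OF lin])
  also have "(\<lambda>z. P (cross (cross z y) x)) = (\<lambda>z. g x y *\<^sub>R P z - g z x *\<^sub>R P y)"
  proof
    fix z
    have "cross (cross z y) x = cross x (cross y z)"
      by (simp add: cross_skew[of x] cross_skew[of z] cross_simps)
    then show "P (cross (cross z y) x) = g x y *\<^sub>R P z - g z x *\<^sub>R P y"
      by (simp add: cross_cross linear_diff[OF linear_P] linear_scale[OF linear_P] g_commute)
  qed
  also have "lin_trace \<dots> = g x y * lin_trace P - g (P y) x"
    by (simp only: lin_trace_diff lin_trace_scale lin_trace_rank_one[OF linear_g_left])
  also have "g (P y) x = g (P x) y"
    by (simp add: curv_op_def g_simps g_commute[of y x] selfadjoint_A g_commute[of y])
  also have "g x y * lin_trace P - g (P x) y = g (Q x) y"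
    unfolding lin_trace_P by (simp add: ricci_op_def curv_op_def g_simps algebra_simps)
  finally show ?thesis .
qed

lemma linear_Q: "linear Q"
  by (auto simp: ricci_op_def A_simps algebra_simps intro!: linearI)

lemma A_Q_commute: "A (Q x) = Q (A x)"
  by (simp add: ricci_op_def A_simps)

lemma lie_derivative_br:
  "lie_derivative_metric br g X y z = g (cross X (A y) - A (cross X y)) z"
  by (simp add: lie_derivative_metric_def br_eq_A_cross g_simps selfadjoint_A[symmetric] g_cross_skew)

lemma ricci_soliton_br:
  "ricci_soliton br g X l \<longleftrightarrow> (\<forall>y. Q y - l *\<^sub>R y = A (cross X y) - cross X (A y))"
proof -
  have "ricci_soliton br g X l \<longleftrightarrow>
      (\<forall>y z. g (Q y - l *\<^sub>R y) z = g (A (cross X y) - cross X (A y)) z)"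
    by (simp add: ricci_soliton_def lie_derivative_br ricci_br g_simps algebra_simps)
  then show ?thesis by (metis eq_if_g_eq)
qed

lemma ricci_soliton_basis:
  "ricci_soliton br g X l \<longleftrightarrow>
    (\<forall>y\<in>{e1, e2, e3}. Q y - l *\<^sub>R y = A (cross X y) - cross X (A y))"
proof -
  have "linear (\<lambda>y. Q y - l *\<^sub>R y)" "linear (\<lambda>y. A (cross X y) - cross X (A y))"
    by (auto simp: linear_add[OF linear_Q] linear_scale[OF linear_Q] A_simps cross_simps algebra_simps intro!: linearI)
  from linear_eqI_basis[OF this] show ?thesis unfolding ricci_soliton_br by auto
qed

lemma einstein_br: "einstein br g \<longleftrightarrow> (\<exists>c. \<forall>x. Q x = c *\<^sub>R x)"
  unfolding einstein_def ricci_br by (metis eq_if_g_eq bilinear_lmul[OF bilinear_g] real_scaleR_def)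

end
section \<open>Solitons and null eigenvectors\<close>

context ppm_frame
begin

lemma g_cross_cyclic: "g (cross x y) z = g (cross y z) x"
  by (rule vec3_cases[of x], rule vec3_cases[of y], rule vec3_cases[of z])
     (simp add: algebra_simps)

lemma cross_basis: "cross e2 e3 = e1" "cross e3 e1 = e2" "cross e1 e2 = - e3"
  by (simp_all add: cross_def vec3_def)

lemma g_cross_self: "g (cross x y) x = 0" "g (cross x y) y = 0"
proof -
  obtain a b c a' b' c' where "x = vec3 a b c" "y = vec3 a' b' c'"
    using vec3_cases by metis
  then show "g (cross x y) x = 0" "g (cross x y) y = 0" by (simp_all add: algebra_simps)
qed

text \<open>With the first two traces zero the adjugate of \<open>T\<close> is its square. Hence the
  cube paired with \<open>z\<close> is the determinant of \<open>T x\<close>, \<open>T y\<close>,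
  \<open>T z\<close>, so the cube is a scalar \<open>d\<close>, and its trace \<open>3 * d\<close>
  vanishes.\<close>

lemma nilpotent_if_traces_zero:
  assumes lin: "linear T" and self: "\<And>x y. g (T x) y = g x (T y)"
    and tr: "lin_trace T = 0" "lin_trace (\<lambda>x. T (T x)) = 0" "lin_trace (\<lambda>x. T (T (T x))) = 0"
  shows "T (T (T x)) = 0"
proof -
  have cross_T: "cross (T x) (T y) = T (T (cross x y))" for x y
    using cross_selfadjoint_both[OF lin self] by (simp add: tr)
  have T3: "g (T (T (T (cross x y)))) z = g (cross (T x) (T y)) (T z)" for x y z
    by (simp add: self cross_T)
  have linT3: "linear (\<lambda>x. T (T (T x)))"
    using linear_compose[OF linear_compose[OF lin lin] lin] by (simp add: o_def)
  define d where "d = g (cross (T e2) (T e3)) (T e1)"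
  have d: "g (cross (T e3) (T e1)) (T e2) = d" "g (cross (T e1) (T e2)) (T e3) = d"
    unfolding d_def by (metis g_cross_cyclic)+
  have 1: "T (T (T e1)) = vec3 d 0 0"
    using T3[of e2 e3 e1] T3[of e2 e3 e2] T3[of e2 e3 e3] vec3_g[of "T (T (T e1))"]
    by (simp add: cross_basis d_def g_cross_self)
  have 2: "T (T (T e2)) = vec3 0 d 0"
    using T3[of e3 e1 e1] T3[of e3 e1 e2] T3[of e3 e1 e3] vec3_g[of "T (T (T e2))"]
    by (simp add: cross_basis d g_cross_self)
  have 3: "T (T (T e3)) = vec3 0 0 d"
    using T3[of e1 e2 e1] T3[of e1 e2 e2] T3[of e1 e2 e3] vec3_g[of "T (T (T e3))"]
    by (simp add: cross_basis d g_cross_self linear_neg[OF lin] g_simps)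
  have "d = 0"
    using tr(3) unfolding lin_trace_basis[OF linT3] by (simp add: 1 2 3)
  then have "T (T (T e1)) = 0" "T (T (T e2)) = 0" "T (T (T e3)) = 0"
    by (simp_all add: 1 2 3 vec3_basis)
  then show ?thesis
    by (rule_tac vec3_cases[of x]) (simp add: linear_vec3[OF linT3])
qed

text \<open>A Lorentzian form has no totally null plane. The null and orthogonality conditions say
  that the first two coordinates of \<open>r *\<^sub>R w - r' *\<^sub>R v\<close> have vanishing sum
  of squares, and its third coordinate is zero anyway.\<close>

lemma null_collinear:
  assumes "g v v = 0" "g w w = 0" "g v w = 0" "v \<noteq> 0"
  obtains a where "w = a *\<^sub>R v"
proof -
  obtain p q r where v: "v = vec3 p q r" by (rule vec3_cases)
  obtain p' q' r' where w: "w = vec3 p' q' r'" by (rule vec3_cases)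
  have n: "p * p + q * q = r * r" "p' * p' + q' * q' = r' * r'" "p * p' + q * q' = r * r'"
    using assms(1-3) by (auto simp: v w)
  have "r \<noteq> 0"
  proof
    assume "r = 0"
    then have "p = 0 \<and> q = 0" using n(1) by (simp add: sum_squares_eq_zero_iff)
    then show False using assms(4) \<open>r = 0\<close> by (simp add: v vec3_basis)
  qed
  have "(r * p' - r' * p)\<^sup>2 + (r * q' - r' * q)\<^sup>2 = 0"
    using n by algebra
  then have "r * p' = r' * p" "r * q' = r' * q"
    by (simp_all add: sum_power2_eq_zero_iff)
  then have "w = (r' / r) *\<^sub>R v"
    using \<open>r \<noteq> 0\<close> by (simp add: v w field_simps)
  then show ?thesis using that by blast
qed

text \<open>A self-adjoint operator of square zero has totally null image, here a line, and whatever
  commutes with it preserves that line.\<close>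

lemma null_eigenvector_if_commuting_nilpotent:
  assumes lin: "linear A" "linear N" and self: "\<And>x y. g (N x) y = g x (N y)"
    and comm: "\<And>x. A (N x) = N (A x)" and sq: "\<And>x. N (N x) = 0" and "N u \<noteq> 0"
  obtains v a where "v \<noteq> 0" "g v v = 0" "A v = a *\<^sub>R v"
proof -
  have iso: "g (N x) (N y) = 0" for x y
    by (simp add: self sq g_simps)
  obtain a where "A (N u) = a *\<^sub>R N u"
    using null_collinear[of "N u" "N (A u)"] iso \<open>N u \<noteq> 0\<close> comm by metis
  then show ?thesis using that iso \<open>N u \<noteq> 0\<close> by blast
qed

end

text \<open>Cyclicity, with \<open>S\<close> moved past \<open>A\<close>. It is applied to
  \<open>K = cross X\<close> and to powers \<open>S\<close> of the commutator itself.\<close>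

lemma lin_trace_commutator:
  fixes A :: "'a::euclidean_space \<Rightarrow> 'a"
  assumes "linear A" "linear K" "linear S" and comm: "\<And>x. A (S x) = S (A x)"
  shows "lin_trace (\<lambda>x. A (K (S x)) - K (A (S x))) = 0"
proof -
  have "linear (\<lambda>x. K (S x))"
    using linear_compose[OF assms(3,2)] by (simp add: o_def)
  from lin_trace_compose_commute[OF assms(1) this] show ?thesis
    by (simp add: lin_trace_diff comm)
qed

section \<open>Normal forms\<close>

text \<open>
  The six-parameter family of self-adjoint operators shrinks to this one when \<open>e2 - e3\<close> is an
  eigenvector, of eigenvalue \<open>a\<close>.
\<close>

definition null_form ::
    "('a::real_vector \<Rightarrow> 'a \<Rightarrow> 'a) \<Rightarrow> 'a \<Rightarrow> 'a \<Rightarrow> 'a \<Rightarrow> real \<Rightarrow> real \<Rightarrow> real \<Rightarrow> real \<Rightarrow> bool" where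
  "null_form br e1 e2 e3 a b c d \<longleftrightarrow>
     br e1 e2 = - (c *\<^sub>R e1) - a *\<^sub>R e3 - d *\<^sub>R (e2 - e3) \<and>
     br e1 e3 = - (c *\<^sub>R e1) - a *\<^sub>R e2 - d *\<^sub>R (e2 - e3) \<and>
     br e2 e3 = b *\<^sub>R e1 + c *\<^sub>R (e2 - e3)"

context ppm_lie_algebra
begin

lemma null_form_vec3:
  "null_form br e1 e2 e3 a b c d \<longleftrightarrow> br e1 e2 = vec3 (- c) (- d) (d - a) \<and>
     br e1 e3 = vec3 (- c) (- a - d) d \<and> br e2 e3 = vec3 b c (- c)"
  by (simp add: null_form_def vec3_def algebra_simps)

text \<open>
  The null rotation fixing \<open>v = e2 - e3\<close> sends \<open>e1\<close> to \<open>e1 + t v\<close> and \<open>w = e2 + e3\<close> to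
  \<open>w - 2 t e1 - t\<^sup>2 v\<close>; the boost sends \<open>v\<close> to \<open>k v\<close> and \<open>w\<close> to \<open>w / k\<close>.
\<close>

lemma null_form_rotate:
  assumes dim: "DIM('a) = 3" and nf: "null_form br e1 e2 e3 a b c d"
  obtains f1 f2 f3 where "orthonormal_basis_ppm g f1 f2 f3"
    "null_form br f1 f2 f3 a b (c + t * (a - b)) (d - 2 * t * c - t\<^sup>2 * (a - b))"
proof
  let ?f1 = "vec3 1 t (- t)" and ?f2 = "vec3 (- t) (1 - t\<^sup>2 / 2) (t\<^sup>2 / 2)"
  let ?f3 = "vec3 (- t) (- t\<^sup>2 / 2) (1 + t\<^sup>2 / 2)"
  show "orthonormal_basis_ppm g ?f1 ?f2 ?f3"
    by (rule orthonormal_basis_ppmI[OF dim symmetric_g])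
       (simp_all add: power2_eq_square field_simps)
  have e: "br e1 e2 = vec3 (- c) (- d) (d - a)" "br e1 e3 = vec3 (- c) (- a - d) d"
    "br e2 e3 = vec3 b c (- c)"
    using nf by (auto simp: null_form_vec3)
  show "null_form br ?f1 ?f2 ?f3 a b (c + t * (a - b)) (d - 2 * t * c - t\<^sup>2 * (a - b))"
    unfolding null_form_def br_vec3 e by (simp add: power2_eq_square field_simps)
qed

lemma null_form_boost:
  assumes dim: "DIM('a) = 3" and nf: "null_form br e1 e2 e3 a b c d" and k: "k \<noteq> 0"
  obtains f1 f2 f3 where "orthonormal_basis_ppm g f1 f2 f3"
    "null_form br f1 f2 f3 a b (c / k) (d / k\<^sup>2)"
proof
  let ?f2 = "vec3 0 ((k + 1 / k) / 2) ((1 / k - k) / 2)"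
  let ?f3 = "vec3 0 ((1 / k - k) / 2) ((k + 1 / k) / 2)"
  show "orthonormal_basis_ppm g (vec3 1 0 0) ?f2 ?f3"
    by (rule orthonormal_basis_ppmI[OF dim symmetric_g])
       (simp_all add: power2_eq_square field_simps k)
  have e: "br e1 e2 = vec3 (- c) (- d) (d - a)" "br e1 e3 = vec3 (- c) (- a - d) d"
    "br e2 e3 = vec3 b c (- c)"
    using nf by (auto simp: null_form_vec3)
  show "null_form br (vec3 1 0 0) ?f2 ?f3 a b (c / k) (d / k\<^sup>2)"
    unfolding null_form_def br_vec3 e by (simp add: power2_eq_square field_simps k)
qed

end

section \<open>Reduction of a non-Einstein soliton to type II or III\<close>

context ppm_unimodular
begin

lemma soliton_null_eigenvector:
  assumes sol: "ricci_soliton br g X l" and ne: "\<not> einstein br g"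
  obtains v a where "v \<noteq> 0" "g v v = 0" "A v = a *\<^sub>R v"
proof -
  define T where "T x = Q x - l *\<^sub>R x" for x
  have lin: "linear T"
    by (auto simp: T_def linear_add[OF linear_Q] linear_scale[OF linear_Q] algebra_simps
        intro!: linearI)
  have lin2: "linear (\<lambda>x. T (T x))"
    using linear_compose[OF lin lin] by (simp add: o_def)
  have self: "g (T x) y = g x (T y)" for x y
    by (simp add: T_def ricci_op_def g_simps selfadjoint_A)
  have comm: "A (T x) = T (A x)" for x
    by (simp add: T_def A_simps A_Q_commute)
  have T: "T x = A (cross X x) - cross X (A x)" for x
    using sol unfolding ricci_soliton_br T_def by blast
  have "lin_trace (\<lambda>x. T (S x)) = 0" if "linear S" "\<And>x. A (S x) = S (A x)" for S
    unfolding T using lin_trace_commutator[OF linear_A linear_cross(1) that] by simp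
  \<comment> \<open>The identity, \<open>T\<close> and its square all commute with \<open>A\<close>;
    testing against them gives the traces of the first three powers of \<open>T\<close>.\<close>
  from this[of "\<lambda>x. x"] this[of T] this[of "\<lambda>x. T (T x)"]
  have nil: "T (T (T x)) = 0" for x
    by (intro nilpotent_if_traces_zero[OF lin self]) (simp_all add: linear_ident lin lin2 comm)
  obtain u where "T u \<noteq> 0"
    using ne unfolding einstein_br T_def by (metis eq_iff_diff_eq_0)
  show ?thesis
  \<comment> \<open>The operator of square zero is \<open>T\<close> itself, or else its square,
    since the cube of \<open>T\<close> vanishes.\<close>
  proof (cases "\<forall>x. T (T x) = 0")
    case True
    with that show ?thesis
      by (rule_tac null_eigenvector_if_commuting_nilpotent[OF linear_A lin self comm _ \<open>T u \<noteq> 0\<close>]) auto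
  next
    case False
    then obtain u' where "T (T u') \<noteq> 0" by blast
    then show ?thesis
      using that by (rule_tac null_eigenvector_if_commuting_nilpotent[OF linear_A lin2 _ _ _ \<open>T (T u') \<noteq> 0\<close>])
        (auto simp: self comm nil linear_0[OF lin])
  qed
qed

lemma null_form_if_null_eigenvector:
  assumes dim: "DIM('a) = 3" and v: "v \<noteq> 0" "g v v = 0" "A v = a *\<^sub>R v"
  obtains f1 f2 f3 b c d where "orthonormal_basis_ppm g f1 f2 f3" "null_form br f1 f2 f3 a b c d"
proof -
  obtain p q r where v_eq: "v = vec3 p q r" by (rule vec3_cases)
  have n: "p * p + q * q = r * r" using v(2) by (simp add: v_eq)
  have "r \<noteq> 0"
  proof
    assume "r = 0"
    then have "p = 0 \<and> q = 0" using n by (simp add: sum_squares_eq_zero_iff)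
    then show False using v(1) \<open>r = 0\<close> by (simp add: v_eq vec3_basis)
  qed
  \<comment> \<open>A rotation of the \<open>e1\<close>, \<open>e2\<close> plane: \<open>s\<close>
    and \<open>t\<close> make \<open>?f2 - ?f3\<close> a multiple of \<open>v\<close>, and nullity
    of \<open>v\<close> makes them a unit vector.\<close>
  define s where "s = - p / r"
  define t where "t = - q / r"
  have st: "s * s + t * t = 1"
    using n \<open>r \<noteq> 0\<close> by (simp add: s_def t_def field_simps)
  let ?f1 = "vec3 t (- s) 0" and ?f2 = "vec3 s t 0" and ?f3 = "vec3 0 0 1"
  have onb: "orthonormal_basis_ppm g ?f1 ?f2 ?f3"
    by (rule orthonormal_basis_ppmI[OF dim symmetric_g]) (use st in \<open>simp_all add: algebra_simps\<close>)
  interpret f: ppm_unimodular g ?f1 ?f2 ?f3 br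
    by unfold_locales (use symmetric_g onb bilinear_br br_self unimodular_br in auto)
  \<comment> \<open>The new frame has the same orientation as the old one; otherwise
    \<open>cross\<close>, and with it the operator, would change sign.\<close>
  have f_A: "f.struct_op = A"
  proof
    fix x show "f.struct_op x = A x"
    proof (rule f.linear_eqI_basis[OF f.linear_A linear_A])
      have e3: "br e1 e2 = - A (vec3 0 0 1)"
        by (simp add: A_basis vec3_basis)
      show "f.struct_op ?f3 = A ?f3"
        unfolding f.A_basis br_vec3 using st by (simp add: e3 add.commute[of "t * t"])
    qed (simp_all add: f.A_basis br_vec3 linear_vec3[OF linear_A] A_basis algebra_simps)
  qed
  have "?f2 - ?f3 = (- 1 / r) *\<^sub>R v"
    using \<open>r \<noteq> 0\<close> by (simp add: v_eq s_def t_def)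
  then have eig: "A (?f2 - ?f3) = a *\<^sub>R (?f2 - ?f3)"
    using v(3) by (simp only: A_simps) simp
  obtain s11 s12 s13 s22 s23 s33 where Af: "A ?f1 = f.vec3 s11 s12 (- s13)"
      "A ?f2 = f.vec3 s12 s22 (- s23)" "A ?f3 = f.vec3 s13 s23 (- s33)"
    using f.selfadjoint_vec3[OF linear_A selfadjoint_A] by metis
  have "f.vec3 s12 s22 (- s23) - f.vec3 s13 s23 (- s33) = a *\<^sub>R f.vec3 0 1 (- 1)"
    using eig unfolding A_simps Af by (simp add: f.vec3_def)
  then have s: "s13 = s12" "s22 = s23 + a" "s33 = s23 - a"
    by auto
  have "null_form br ?f1 ?f2 ?f3 a s11 s12 s23"
  proof -
    have "br ?f1 ?f2 = - A ?f3" "br ?f1 ?f3 = - A ?f2" "br ?f2 ?f3 = A ?f1"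
      using f.A_basis unfolding f_A by simp_all
    then show ?thesis unfolding f.null_form_vec3 by (simp add: Af s)
  qed
  then show ?thesis using that onb by blast
qed

text \<open>In a frame that diagonalises \<open>A\<close>, the commutator of \<open>A\<close> with
  \<open>cross X\<close> has zero diagonal, whereas \<open>Q - l\<close> is diagonal; hence
  \<open>Q = l\<close>.\<close>

lemma einstein_if_diagonal:
  assumes sol: "ricci_soliton br g X l" and nf: "null_form br e1 e2 e3 a b 0 0"
  shows "einstein br g"
proof -
  have A: "A e1 = vec3 b 0 0" "A e2 = vec3 0 a 0" "A e3 = vec3 0 0 a"
    using nf by (auto simp: A_basis null_form_vec3)
  have A2: "A (vec3 x y z) = vec3 (b * x) (a * y) (a * z)" for x y z
    by (simp add: linear_vec3[OF linear_A] A mult.commute)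
  have tr: "lin_trace A = b + 2 * a" "lin_trace (\<lambda>x. A (A x)) = b * b + 2 * a * a"
    by (simp_all add: lin_trace_basis[OF linear_A] lin_trace_basis[OF linear_A2] A A2)
  have Q: "Q (vec3 x y z) = vec3 (- (b * b / 2) * x) ((b * b / 2 - a * b) * y) ((b * b / 2 - a * b) * z)" for x y z
    by (simp add: ricci_op_def tr A2 power2_eq_square field_simps)
  obtain p q r where X: "X = vec3 p q r" by (rule vec3_cases)
  have eq: "Q y - l *\<^sub>R y = A (cross X y) - cross X (A y)" for y
    using sol unfolding ricci_soliton_br by blast
  have "l = - (b * b / 2)" "l = b * b / 2 - a * b"
    using eq[of "vec3 1 0 0"] eq[of "vec3 0 1 0"] by (simp_all add: X Q A2)
  then have "- (b * b / 2) = l" "b * b / 2 - a * b = l" by simp_all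
  then have "Q x = l *\<^sub>R x" for x
    by (rule_tac vec3_cases[of x]) (simp only: Q vec3_arith)
  then show ?thesis unfolding einstein_br by blast
qed

end

text \<open>If \<open>a \<noteq> b\<close>, a null rotation removes \<open>c\<close> and a boost
  normalises \<open>d\<close>: type II. If \<open>a = b\<close>, then \<open>c\<close> is unaffected
  by rotation: \<open>c = 0\<close> is again type II, while for \<open>c \<noteq> 0\<close> a
  rotation removes \<open>d\<close> and a boost normalises \<open>c\<close>: type III.\<close>

lemma soliton_normal_form:
  fixes br :: "'a::euclidean_space \<Rightarrow> 'a \<Rightarrow> 'a" and g :: "'a \<Rightarrow> 'a \<Rightarrow> real"
  assumes dim: "DIM('a) = 3" and "ppm_unimodular g e1 e2 e3 br"
    and sol: "ricci_soliton br g X l" and ne: "\<not> einstein br g"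
  obtains f1 f2 f3 \<alpha> \<beta> where "orthonormal_basis_ppm g f1 f2 f3" "algebra_II br f1 f2 f3 \<alpha> \<beta>"
    | f1 f2 f3 \<alpha> where "orthonormal_basis_ppm g f1 f2 f3" "algebra_III br f1 f2 f3 \<alpha>"
proof -
  note II = that(1) and III = that(2)
  interpret ppm_unimodular g e1 e2 e3 br by fact
  have frame: "ppm_unimodular g f1 f2 f3 br" if "orthonormal_basis_ppm g f1 f2 f3" for f1 f2 f3
    by unfold_locales (use that symmetric_g bilinear_br br_self unimodular_br in auto)
  have rotate: "\<exists>f1 f2 f3. orthonormal_basis_ppm g f1 f2 f3 \<and>
      null_form br f1 f2 f3 a b (c + t * (a - b)) (d - 2 * t * c - t\<^sup>2 * (a - b))"
    if "orthonormal_basis_ppm g f1 f2 f3" "null_form br f1 f2 f3 a b c d" for f1 f2 f3 a b c d t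
  proof -
    interpret f: ppm_unimodular g f1 f2 f3 br by (rule frame) fact
    show ?thesis using f.null_form_rotate[OF dim that(2), of t] by blast
  qed
  have boost: "\<exists>f1 f2 f3. orthonormal_basis_ppm g f1 f2 f3 \<and> null_form br f1 f2 f3 a b (c / k) (d / k\<^sup>2)"
    if "orthonormal_basis_ppm g f1 f2 f3" "null_form br f1 f2 f3 a b c d" "k \<noteq> 0" for f1 f2 f3 a b c d k
  proof -
    interpret f: ppm_unimodular g f1 f2 f3 br by (rule frame) fact
    show ?thesis using f.null_form_boost[OF dim that(2,3)] by blast
  qed
  have nondiag: "d \<noteq> 0"
    if "orthonormal_basis_ppm g f1 f2 f3" "null_form br f1 f2 f3 a b 0 d" for f1 f2 f3 a b d
  proof -
    interpret f: ppm_unimodular g f1 f2 f3 br by (rule frame) fact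
    show ?thesis using f.einstein_if_diagonal[OF sol] that(2) ne by blast
  qed
  have type_II: thesis
    if f: "orthonormal_basis_ppm g f1 f2 f3" "null_form br f1 f2 f3 a b 0 d" for f1 f2 f3 a b d
  proof -
    \<comment> \<open>The boost reduces \<open>d\<close> to plus or minus one half. Negating the
      third vector turns the null eigenvector \<open>f2 - f3\<close> into the sum of the last two
      vectors, as in type II, and the factor \<open>?s\<close> on the first vector absorbs the sign
      of \<open>d\<close>.\<close>
    let ?k = "sqrt (2 * \<bar>d\<bar>)" and ?s = "- sgn d"
    have "d \<noteq> 0" using nondiag[OF f] .
    then have k: "?k \<noteq> 0" "d / ?k\<^sup>2 = sgn d / 2" "0 / ?k = 0"
      by (simp_all add: sgn_if)
    obtain f1 f2 f3 where h: "orthonormal_basis_ppm g f1 f2 f3"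
        "null_form br f1 f2 f3 a b 0 (sgn d / 2)"
      using boost[OF f k(1)] unfolding k(2,3) by blast
    interpret h: ppm_unimodular g f1 f2 f3 br by (rule frame) fact
    have onb: "orthonormal_basis_ppm g (?s *\<^sub>R f1) f2 (- f3)"
      using \<open>d \<noteq> 0\<close> by (intro orthonormal_basis_ppmI[OF dim symmetric_g])
        (simp_all add: h.g_simps sgn_if)
    have "algebra_II br (?s *\<^sub>R f1) f2 (- f3) (- ?s * b) (- ?s * a)"
      using h(2) \<open>d \<noteq> 0\<close> unfolding algebra_II_def null_form_def
      by (auto simp: h.br_simps sgn_if algebra_simps simp flip: scaleR_left_distrib)
    with onb show thesis by (rule II)
  qed
  obtain v a where v: "v \<noteq> 0" "g v v = 0" "A v = a *\<^sub>R v"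
    using soliton_null_eigenvector[OF sol ne] by blast
  obtain f1 f2 f3 b c d where f: "orthonormal_basis_ppm g f1 f2 f3" "null_form br f1 f2 f3 a b c d"
    using null_form_if_null_eigenvector[OF dim v] by blast
  show thesis
  proof (cases "a = b")
    case False
    then have "c + (c / (b - a)) * (a - b) = 0" by (simp add: field_simps)
    then show thesis using rotate[OF f, of "c / (b - a)"] type_II by auto
  next
    case ab: True
    show thesis
    proof (cases "c = 0")
      case True then show thesis using type_II f by blast
    next
      case False
      then obtain f1 f2 f3 where f: "orthonormal_basis_ppm g f1 f2 f3" "null_form br f1 f2 f3 a a c 0"
        using rotate[OF f, of "d / (2 * c)"] ab by auto
      \<comment> \<open>A negative \<open>c\<close> is allowed: the boost parameter then is negative
        as well and absorbs the sign.\<close>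
      then obtain f1 f2 f3 where f: "orthonormal_basis_ppm g f1 f2 f3"
          "null_form br f1 f2 f3 a a (1 / sqrt 2) 0"
        using boost[OF f, of "sqrt 2 * c"] False by auto
      then have "algebra_III br f1 f2 f3 a"
        by (auto simp: algebra_III_def null_form_def algebra_simps)
      with f(1) show thesis by (rule III)
    qed
  qed
qed

section \<open>Geometry of the algebras of types II and III\<close>

lemma matrix_add_rdistrib: "(B + C) ** A = B ** A + C ** (A :: real^'n^'m)"
  by (vector matrix_matrix_mult_def sum.distrib field_simps)

lemma (in ppm_frame) lin_trace_perp_proj:
  assumes "g u u \<noteq> 0"
  shows "lin_trace (perp_proj g u) = 2"
proof -
  have "linear (\<lambda>x. g x u / g u u)"
    by (auto simp: g_simps linear_iff add_divide_distrib)
  from lin_trace_rank_one[OF this, of u] show ?thesis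
    using assms unfolding perp_proj_def[abs_def]
    by (simp add: lin_trace_diff lin_trace_id)
qed

context ppm_unimodular
begin

text \<open>The Ricci operator of a product is \<open>c\<close> times the projection along the line
  factor. It kills the line direction, and its trace is \<open>2 * c\<close>, so trace zero means
  that it vanishes.\<close>

lemma einstein_or_kernel_if_product:
  assumes "product_line_surface br g"
  obtains u where "u \<noteq> 0" "Q u = 0" "lin_trace Q = 0 \<longrightarrow> (\<forall>x. Q x = 0)"
proof -
  obtain u c where u: "g u u \<noteq> 0" and R: "curvature br g x y z =
      c *\<^sub>R (g (perp_proj g u y) (perp_proj g u z) *\<^sub>R perp_proj g u x
        - g (perp_proj g u x) (perp_proj g u z) *\<^sub>R perp_proj g u y)" for x y z
    using assms unfolding product_line_surface_def Let_def by blast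
  let ?p = "perp_proj g u"
  have lin: "linear ?p"
    by (auto simp: perp_proj_def g_simps linear_iff algebra_simps add_divide_distrib)
  have perp: "g (?p x) u = 0" for x
    using u by (simp add: perp_proj_def g_simps)
  have p: "g (?p x) (?p y) = g (?p x) y" "g (?p (?p x)) y = g (?p x) y" for x y
    using perp by (simp_all add: perp_proj_def[of g u "?p x"] perp_proj_def[of g u y] g_simps)
  have tr: "lin_trace ?p = 2"
    using u by (rule lin_trace_perp_proj)
  have "ricci br g x y = g (c *\<^sub>R ?p x) y" for x y
  proof -
    have "linear (\<lambda>z. g (?p z) (?p y))"
      using linear_compose[OF lin linear_g_left] by (simp add: o_def)
    from lin_trace_rank_one[OF this] show ?thesis
      unfolding ricci_def R
      by (simp add: lin_trace_diff lin_trace_scale tr p g_simps)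
  qed
  then have Q: "Q = (\<lambda>x. c *\<^sub>R ?p x)"
    unfolding ricci_br by (intro ext eq_if_g_eq)
  show ?thesis
  proof
    show "u \<noteq> 0" using u by (auto simp: g_simps)
    show "Q u = 0" using u by (simp add: Q perp_proj_def)
    show "lin_trace Q = 0 \<longrightarrow> (\<forall>x. Q x = 0)"
      by (simp add: Q lin_trace_scale tr)
  qed
qed

end

section \<open>Identification of the Lie algebras\<close>

context ppm_lie_algebra
begin

text \<open>The isomorphism sends \<open>ei\<close> to \<open>Hi\<close>: the first three hypotheses
  make the \<open>Hi\<close> a basis of \<open>S\<close>, and by bilinearity and antisymmetry three
  brackets suffice. In \<open>\<phi>\<close> the last sign recovers the third coordinate from
  \<open>g x e3\<close>.\<close>

lemma iso_matrix_lie_algebraI: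
  fixes H1 H2 H3 :: "real^'n^'n"
  assumes inj: "\<And>a b c. a *\<^sub>R H1 + b *\<^sub>R H2 + c *\<^sub>R H3 = 0 \<Longrightarrow> a = 0 \<and> b = 0 \<and> c = 0"
    and mem: "\<And>a b c. a *\<^sub>R H1 + b *\<^sub>R H2 + c *\<^sub>R H3 \<in> S"
    and span: "\<And>B. B \<in> S \<Longrightarrow> \<exists>a b c. B = a *\<^sub>R H1 + b *\<^sub>R H2 + c *\<^sub>R H3"
    and br12: "br e1 e2 = vec3 p q r" "H1 ** H2 - H2 ** H1 = p *\<^sub>R H1 + q *\<^sub>R H2 + r *\<^sub>R H3"
    and br13: "br e1 e3 = vec3 p' q' r'" "H1 ** H3 - H3 ** H1 = p' *\<^sub>R H1 + q' *\<^sub>R H2 + r' *\<^sub>R H3"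
    and br23: "br e2 e3 = vec3 p'' q'' r''" "H2 ** H3 - H3 ** H2 = p'' *\<^sub>R H1 + q'' *\<^sub>R H2 + r'' *\<^sub>R H3"
  shows "iso_matrix_lie_algebra br S"
  unfolding iso_matrix_lie_algebra_def
proof (intro exI conjI allI)
  define \<phi> where "\<phi> x = g x e1 *\<^sub>R H1 + g x e2 *\<^sub>R H2 - g x e3 *\<^sub>R H3" for x
  have \<phi>: "\<phi> (vec3 a b c) = a *\<^sub>R H1 + b *\<^sub>R H2 + c *\<^sub>R H3" for a b c
    by (simp add: \<phi>_def)
  show lin: "linear \<phi>"
    by (auto simp: \<phi>_def g_simps algebra_simps intro!: linearI)
  have "inj \<phi>"
    unfolding linear_injective_0[OF lin] by (metis \<phi> inj vec3_cases vec3_basis(4))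
  moreover have "range \<phi> = S"
  proof
    show "range \<phi> \<subseteq> S" by (metis \<phi> mem vec3_cases image_subsetI)
    show "S \<subseteq> range \<phi>" using span \<phi> by (metis rangeI subsetI)
  qed
  ultimately show "bij_betw \<phi> UNIV S" by (simp add: bij_betw_def)
  fix x y
  obtain a b c where x: "x = vec3 a b c" by (rule vec3_cases)
  obtain a' b' c' where y: "y = vec3 a' b' c'" by (rule vec3_cases)
  have "\<phi> x ** \<phi> y - \<phi> y ** \<phi> x = (a * b' - b * a') *\<^sub>R (H1 ** H2 - H2 ** H1) +
      (a * c' - c * a') *\<^sub>R (H1 ** H3 - H3 ** H1) + (b * c' - c * b') *\<^sub>R (H2 ** H3 - H3 ** H2)"
    unfolding x y \<phi>
    by (simp add: matrix_add_ldistrib matrix_add_rdistrib matrix_scalar_ac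
        scalar_matrix_assoc[symmetric] algebra_simps)
  then show "\<phi> (br x y) = \<phi> x ** \<phi> y - \<phi> y ** \<phi> x"
    unfolding br12(2) br13(2) br23(2) x y br_vec3
    by (simp add: br12(1) br13(1) br23(1) \<phi> algebra_simps)
qed

lemma algebra_II_vec3:
  "algebra_II br e1 e2 e3 \<alpha> \<beta> \<longleftrightarrow> br e1 e2 = vec3 0 (1/2) (1/2 - \<beta>) \<and>
     br e1 e3 = vec3 0 (- \<beta> - 1/2) (- 1/2) \<and> br e2 e3 = vec3 \<alpha> 0 0"
  by (simp add: algebra_II_def vec3_def algebra_simps)

lemma algebra_III_vec3:
  "algebra_III br e1 e2 e3 \<alpha> \<longleftrightarrow> br e1 e2 = vec3 (- 1 / sqrt 2) 0 (- \<alpha>) \<and>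
     br e1 e3 = vec3 (- 1 / sqrt 2) (- \<alpha>) 0 \<and> br e2 e3 = vec3 \<alpha> (1 / sqrt 2) (- 1 / sqrt 2)"
  by (simp add: algebra_III_def vec3_def)

lemma algebra_II_unimodular:
  assumes "algebra_II br e1 e2 e3 \<alpha> \<beta>"
  shows "ppm_unimodular g e1 e2 e3 br"
  by unfold_locales (use assms in \<open>simp add: unimodular_iff_basis A_basis algebra_II_vec3\<close>)

lemma algebra_III_unimodular:
  assumes "algebra_III br e1 e2 e3 \<alpha>"
  shows "ppm_unimodular g e1 e2 e3 br"
  by unfold_locales (use assms in \<open>simp add: unimodular_iff_basis A_basis algebra_III_vec3\<close>)

text \<open>
  The boost generator of \<open>e11\<close> is diagonal in the translations \<open>(1, 1)\<close> and \<open>(1, -1)\<close>; the constants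
  below send the eigenvectors of \<open>ad e1\<close>, of eigenvalues \<open>\<beta>\<close> and \<open>- \<beta>\<close>, to multiples of these.
\<close>

lemma algebra_II_iso_e11:
  assumes "algebra_II br e1 e2 e3 0 \<beta>" "\<beta> \<noteq> 0"
  shows "iso_matrix_lie_algebra br e11"
proof (rule iso_matrix_lie_algebraI)
  let ?E = "\<lambda>t x y. vector [vector [0, t, x], vector [t, 0, y], vector [0, 0, 0]] :: real^3^3"
  let ?comb = "\<lambda>a b c. a *\<^sub>R ?E \<beta> 0 0 + b *\<^sub>R ?E 0 (\<beta> + 1/2) (3/2 - \<beta>) +
      c *\<^sub>R ?E 0 (\<beta> - 1/2) (- 3/2 - \<beta>)"
  have comb: "?comb a b c = ?E (a * \<beta>) (b * (\<beta> + 1/2) + c * (\<beta> - 1/2))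
      (b * (3/2 - \<beta>) + c * (- 3/2 - \<beta>))" for a b c
    by (simp add: vec_eq_iff forall_3 vector_3)
  show "?comb a b c \<in> e11" for a b c
    unfolding comb e11_def by blast
  show "a = 0 \<and> b = 0 \<and> c = 0" if "?comb a b c = 0" for a b c
  proof -
    have "a * \<beta> = 0" "b * (\<beta> + 1/2) + c * (\<beta> - 1/2) = 0" "b * (3/2 - \<beta>) + c * (- 3/2 - \<beta>) = 0"
      using that unfolding comb by (simp_all add: vec_eq_iff forall_3 vector_3)
    moreover from this(2,3) have "b = c" by (simp add: algebra_simps)
    ultimately show ?thesis using assms(2) by (simp add: algebra_simps)
  qed
  show "\<exists>a b c. B = ?comb a b c" if "B \<in> e11" for B
  proof -
    from that obtain t x y where B: "B = ?E t x y" unfolding e11_def by blast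
    \<comment> \<open>With coefficients \<open>b\<close>, \<open>c\<close> of the last two
      generators, the half-sum of \<open>x\<close> and \<open>y\<close> is \<open>b - c\<close> and
      their half-difference is \<open>b * (\<beta> - 1/2) + c * (\<beta> + 1/2)\<close>; these are
      solved for \<open>b\<close> and \<open>c\<close>.\<close>
    have "B = ?comb (t / \<beta>) (((x - y) / 2 + (\<beta> + 1/2) * ((x + y) / 2)) / (2 * \<beta>))
        (((x - y) / 2 - (\<beta> - 1/2) * ((x + y) / 2)) / (2 * \<beta>))"
      unfolding comb B using assms(2) by (simp add: vec_eq_iff forall_3 vector_3 field_simps)
    then show ?thesis by blast
  qed
  show "br e1 e2 = vec3 0 (1/2) (1/2 - \<beta>)" "br e1 e3 = vec3 0 (- \<beta> - 1/2) (- 1/2)"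
    "br e2 e3 = vec3 0 0 0"
    using assms(1) by (auto simp: algebra_II_vec3)
qed (simp_all add: vec_eq_iff forall_3 vector_3 matrix_matrix_mult_def sum_3 field_simps)

text \<open>The vectors \<open>e1\<close> and \<open>e2 - e3\<close> span an abelian ideal on which
  \<open>ad e2\<close> has eigenvalues \<open>1 / sqrt 2\<close> and \<open>- 1 / sqrt 2\<close>.
  They go to the translations (1, 1) and (1, -1), and \<open>e2\<close> goes to a boost
  generator.\<close>

lemma algebra_III_iso_e11:
  assumes "algebra_III br e1 e2 e3 0"
  shows "iso_matrix_lie_algebra br e11"
proof (rule iso_matrix_lie_algebraI)
  let ?E = "\<lambda>t x y. vector [vector [0, t, x], vector [t, 0, y], vector [0, 0, 0]] :: real^3^3"
  let ?q = "1 / sqrt 2"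
  let ?comb = "\<lambda>a b c. a *\<^sub>R ?E 0 1 1 + b *\<^sub>R ?E ?q 0 0 + c *\<^sub>R ?E ?q (- 1) 1"
  have comb: "?comb a b c = ?E ((b + c) * ?q) (a - c) (a + c)" for a b c
    by (simp add: vec_eq_iff forall_3 vector_3 add_divide_distrib)
  show "?comb a b c \<in> e11" for a b c
    unfolding comb e11_def by blast
  show "a = 0 \<and> b = 0 \<and> c = 0" if "?comb a b c = 0" for a b c
    using that unfolding comb by (auto simp add: vec_eq_iff forall_3 vector_3)
  show "\<exists>a b c. B = ?comb a b c" if "B \<in> e11" for B
  proof -
    from that obtain t x y where B: "B = ?E t x y" unfolding e11_def by blast
    have "B = ?comb ((x + y) / 2) (sqrt 2 * t - (y - x) / 2) ((y - x) / 2)"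
      unfolding comb B by (simp add: vec_eq_iff forall_3 vector_3 field_simps)
    then show ?thesis by blast
  qed
  show "br e1 e2 = vec3 (- 1 / sqrt 2) 0 0" "br e1 e3 = vec3 (- 1 / sqrt 2) 0 0"
    "br e2 e3 = vec3 0 (1 / sqrt 2) (- 1 / sqrt 2)"
    using assms(1) by (auto simp: algebra_III_vec3)
qed (simp_all add: vec_eq_iff forall_3 vector_3 matrix_matrix_mult_def sum_3 algebra_simps)

lemma sl2_eq: "sl2 = {vector [vector [x, y], vector [z, - x]] | x y z. True}"
proof safe
  fix B :: "real^2^2" assume "B \<in> sl2"
  then have "B $ 2 $ 2 = - (B $ 1 $ 1)" by (simp add: sl2_def trace_def sum_2)
  then have "B = vector [vector [B $ 1 $ 1, B $ 1 $ 2], vector [B $ 2 $ 1, - (B $ 1 $ 1)]]"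
    by (simp add: vec_eq_iff forall_2)
  then show "\<exists>x y z. B = vector [vector [x, y], vector [z, - x]] \<and> True" by blast
qed (simp add: sl2_def trace_def sum_2)

text \<open>
  In both remaining cases \<open>ad e1\<close> is diagonalisable, so that \<open>e1\<close> can be sent to a multiple of
  \<open>diag(1, -1)\<close> and its other two eigenvectors to the off-diagonal matrix units.
\<close>

lemma algebra_II_iso_sl2:
  assumes "algebra_II br e1 e2 e3 \<beta> \<beta>" "\<beta> \<noteq> 0"
  shows "iso_matrix_lie_algebra br sl2"
proof (rule iso_matrix_lie_algebraI)
  let ?E = "\<lambda>x y z. vector [vector [x, y], vector [z, - x]] :: real^2^2"
  \<comment> \<open>For \<open>ad e1\<close>, \<open>e2 + e3\<close> has eigenvalue
    \<open>- \<beta>\<close> and goes to \<open>\<beta>\<^sup>2\<close> times the lower matrix unit;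
    \<open>(\<beta> + 1/2) *\<^sub>R e2 + (1/2 - \<beta>) *\<^sub>R e3\<close> has eigenvalue
    \<open>\<beta>\<close> and goes to \<open>\<beta>\<close> times the upper one.\<close>
  let ?comb = "\<lambda>a b c. a *\<^sub>R ?E (\<beta> / 2) 0 0 + b *\<^sub>R ?E 0 (1/2) ((\<beta>\<^sup>2 - \<beta> / 2) / 2)
      + c *\<^sub>R ?E 0 (- 1/2) ((\<beta>\<^sup>2 + \<beta> / 2) / 2)"
  have comb: "?comb a b c = ?E (a * \<beta> / 2) ((b - c) / 2)
      ((b * (\<beta>\<^sup>2 - \<beta> / 2) + c * (\<beta>\<^sup>2 + \<beta> / 2)) / 2)" for a b c
    by (simp add: vec_eq_iff forall_2 field_simps)
  show "?comb a b c \<in> sl2" for a b c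
    unfolding comb sl2_eq by blast
  show "a = 0 \<and> b = 0 \<and> c = 0" if "?comb a b c = 0" for a b c
  proof -
    have "a * \<beta> = 0" "b = c" "b * (\<beta>\<^sup>2 - \<beta> / 2) + c * (\<beta>\<^sup>2 + \<beta> / 2) = 0"
      using that unfolding comb by (auto simp: vec_eq_iff forall_2)
    then show ?thesis using assms(2) by (simp add: algebra_simps)
  qed
  show "\<exists>a b c. B = ?comb a b c" if "B \<in> sl2" for B
  proof -
    from that obtain x y z where B: "B = ?E x y z" unfolding sl2_eq by blast
    have "B = ?comb (2 * x / \<beta>) ((z + \<beta> / 2 * y) / \<beta>\<^sup>2 + y) ((z + \<beta> / 2 * y) / \<beta>\<^sup>2 - y)"
      unfolding comb B using assms(2) by (simp add: vec_eq_iff forall_2 field_simps power2_eq_square)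
    then show ?thesis by blast
  qed
  show "br e1 e2 = vec3 0 (1/2) (1/2 - \<beta>)" "br e1 e3 = vec3 0 (- \<beta> - 1/2) (- 1/2)"
    "br e2 e3 = vec3 \<beta> 0 0"
    using assms(1) by (auto simp: algebra_II_vec3)
qed (simp_all add: vec_eq_iff forall_2 matrix_matrix_mult_def sum_2, (simp_all add: power2_eq_square field_simps)?)

lemma algebra_III_iso_sl2:
  assumes "algebra_III br e1 e2 e3 \<alpha>" "\<alpha> \<noteq> 0"
  shows "iso_matrix_lie_algebra br sl2"
proof (rule iso_matrix_lie_algebraI)
  let ?E = "\<lambda>x y z. vector [vector [x, y], vector [z, - x]] :: real^2^2"
  define q where "q = 1 / sqrt 2"
  \<comment> \<open>For \<open>ad e1\<close>, \<open>e2 - e3\<close> has eigenvalue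
    \<open>\<alpha>\<close> and goes to the upper matrix unit;
    \<open>e2 + e3 + (2 * q / \<alpha>) *\<^sub>R e1\<close> has eigenvalue
    \<open>- \<alpha>\<close> and goes to \<open>\<alpha>\<^sup>2\<close> times the lower
    one.\<close>
  let ?comb = "\<lambda>a b c. a *\<^sub>R ?E (\<alpha> / 2) 0 0 + b *\<^sub>R ?E (- q / 2) (1/2) (\<alpha>\<^sup>2 / 2)
      + c *\<^sub>R ?E (- q / 2) (- 1/2) (\<alpha>\<^sup>2 / 2)"
  have comb: "?comb a b c = ?E ((a * \<alpha> - (b + c) * q) / 2) ((b - c) / 2) ((b + c) * \<alpha>\<^sup>2 / 2)" for a b c
    by (simp add: vec_eq_iff forall_2 field_simps)
  show "?comb a b c \<in> sl2" for a b c
    unfolding comb sl2_eq by blast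
  show "a = 0 \<and> b = 0 \<and> c = 0" if "?comb a b c = 0" for a b c
  proof -
    have "a * \<alpha> = (b + c) * q" "b = c" "(b + c) * \<alpha>\<^sup>2 = 0"
      using that unfolding comb by (auto simp: vec_eq_iff forall_2)
    then show ?thesis using assms(2) by auto
  qed
  show "\<exists>a b c. B = ?comb a b c" if "B \<in> sl2" for B
  proof -
    from that obtain x y z where B: "B = ?E x y z" unfolding sl2_eq by blast
    have "B = ?comb ((2 * x + 2 * z / \<alpha>\<^sup>2 * q) / \<alpha>) (z / \<alpha>\<^sup>2 + y) (z / \<alpha>\<^sup>2 - y)"
      unfolding comb B using assms(2) by (simp add: vec_eq_iff forall_2 field_simps)
    then show ?thesis by blast
  qed
  show "br e1 e2 = vec3 (- q) 0 (- \<alpha>)" "br e1 e3 = vec3 (- q) (- \<alpha>) 0"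
    "br e2 e3 = vec3 \<alpha> q (- q)"
    using assms(1) by (auto simp: algebra_III_vec3 q_def)
qed (simp_all add: vec_eq_iff forall_2 matrix_matrix_mult_def sum_2, (simp_all add: power2_eq_square field_simps)?)

end

section \<open>Ricci operators and the soliton equation in types II and III\<close>

context ppm_unimodular
begin

text \<open>On the \<open>e2\<close>, \<open>e3\<close> plane \<open>A\<close> is
  \<open>\<beta>\<close> plus half the nilpotent map sending (y, z) to (y - z, y - z), so
  \<open>Q\<close> there is a scalar plus a multiple of the same map.\<close>

lemma algebra_II_ricci_op:
  assumes "algebra_II br e1 e2 e3 \<alpha> \<beta>"
  shows "A (vec3 x y z) = vec3 (\<alpha> * x) ((\<beta> + 1/2) * y - z / 2) (y / 2 + (\<beta> - 1/2) * z)"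
    and "Q (vec3 x y z) = vec3 (- \<alpha>\<^sup>2 / 2 * x)
      ((\<alpha>\<^sup>2 / 2 - \<alpha> * \<beta>) * y + (\<alpha> / 2 - \<beta>) * (y - z))
      ((\<alpha>\<^sup>2 / 2 - \<alpha> * \<beta>) * z + (\<alpha> / 2 - \<beta>) * (y - z))"
proof -
  have A: "A e1 = vec3 \<alpha> 0 0" "A e2 = vec3 0 (\<beta> + 1/2) (1/2)" "A e3 = vec3 0 (- 1/2) (\<beta> - 1/2)"
    using assms by (auto simp: A_basis algebra_II_vec3)
  show A': "A (vec3 x y z) = vec3 (\<alpha> * x) ((\<beta> + 1/2) * y - z / 2) (y / 2 + (\<beta> - 1/2) * z)" for x y z
    by (simp add: linear_vec3[OF linear_A] A algebra_simps)
  have tr: "lin_trace A = \<alpha> + 2 * \<beta>" "lin_trace (\<lambda>x. A (A x)) = \<alpha>\<^sup>2 + 2 * \<beta>\<^sup>2"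
    by (simp_all add: lin_trace_basis[OF linear_A] lin_trace_basis[OF linear_A2] A A'
        power2_eq_square field_simps)
  show "Q (vec3 x y z) = vec3 (- \<alpha>\<^sup>2 / 2 * x)
      ((\<alpha>\<^sup>2 / 2 - \<alpha> * \<beta>) * y + (\<alpha> / 2 - \<beta>) * (y - z))
      ((\<alpha>\<^sup>2 / 2 - \<alpha> * \<beta>) * z + (\<alpha> / 2 - \<beta>) * (y - z))"
    by (simp add: ricci_op_def tr A' power2_eq_square field_simps)
qed

text \<open>Here \<open>A\<close> is \<open>\<alpha>\<close> plus an operator N with N^3 = 0, so
  \<open>Q\<close> is \<open>- \<alpha>\<^sup>2 / 2\<close> minus \<open>\<alpha>\<close> times N
  minus twice N^2.\<close>

lemma algebra_III_ricci_op:
  assumes "algebra_III br e1 e2 e3 \<alpha>"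
  shows "A (vec3 x y z) = vec3 (\<alpha> * x + (y + z) / sqrt 2) (\<alpha> * y + x / sqrt 2) (\<alpha> * z - x / sqrt 2)"
    and "Q (vec3 x y z) = vec3 (- \<alpha>\<^sup>2 / 2 * x - \<alpha> / sqrt 2 * (y + z))
      (- \<alpha>\<^sup>2 / 2 * y - \<alpha> / sqrt 2 * x - (y + z)) (- \<alpha>\<^sup>2 / 2 * z + \<alpha> / sqrt 2 * x + (y + z))"
proof -
  have A: "A e1 = vec3 \<alpha> (1 / sqrt 2) (- 1 / sqrt 2)" "A e2 = vec3 (1 / sqrt 2) \<alpha> 0"
    "A e3 = vec3 (1 / sqrt 2) 0 \<alpha>"
    using assms by (auto simp: A_basis algebra_III_vec3)
  show A': "A (vec3 x y z) =
      vec3 (\<alpha> * x + (y + z) / sqrt 2) (\<alpha> * y + x / sqrt 2) (\<alpha> * z - x / sqrt 2)" for x y z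
    by (simp add: linear_vec3[OF linear_A] A add_divide_distrib)
  have tr: "lin_trace A = 3 * \<alpha>" "lin_trace (\<lambda>x. A (A x)) = 3 * \<alpha>\<^sup>2"
    by (simp_all add: lin_trace_basis[OF linear_A] lin_trace_basis[OF linear_A2] A A'
        power2_eq_square field_simps)
  show "Q (vec3 x y z) = vec3 (- \<alpha>\<^sup>2 / 2 * x - \<alpha> / sqrt 2 * (y + z))
      (- \<alpha>\<^sup>2 / 2 * y - \<alpha> / sqrt 2 * x - (y + z)) (- \<alpha>\<^sup>2 / 2 * z + \<alpha> / sqrt 2 * x + (y + z))"
    by (simp add: ricci_op_def tr A' power2_eq_square field_simps)
qed

lemma ricci_soliton_vec3: "ricci_soliton br g X l \<longleftrightarrow>
    (\<forall>y\<in>{vec3 1 0 0, vec3 0 1 0, vec3 0 0 1}. Q y - l *\<^sub>R y = A (cross X y) - cross X (A y))"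
  by (simp add: ricci_soliton_basis vec3_basis)

text \<open>The equation at \<open>e1\<close> gives \<open>l\<close> and the conditions on
  \<open>y\<close> and \<open>z\<close>. The equation at \<open>e2\<close> expresses
  \<open>x\<close> in two ways, and comparing them leaves
  \<open>\<alpha> * (\<alpha> - \<beta>) = 0\<close>.\<close>

lemma algebra_II_soliton_iff:
  assumes "algebra_II br e1 e2 e3 \<alpha> \<beta>"
  shows "ricci_soliton br g (vec3 x y z) l \<longleftrightarrow> l = - \<alpha>\<^sup>2 / 2 \<and> \<alpha> * (\<alpha> - \<beta>) = 0 \<and>
    x = \<alpha> / 2 - \<beta> \<and> (\<alpha> - \<beta>) * y = (z - y) / 2 \<and> (\<alpha> - \<beta>) * z = (z - y) / 2"
proof
  assume sol: "ricci_soliton br g (vec3 x y z) l"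
  then have eq: "Q (vec3 a b c) - l *\<^sub>R vec3 a b c =
      A (cross (vec3 x y z) (vec3 a b c)) - cross (vec3 x y z) (A (vec3 a b c))" for a b c
    unfolding ricci_soliton_br by blast
  note eq = eq[unfolded algebra_II_ricci_op[OF assms] cross_vec3 vec3_arith vec3_inject]
  from eq[where a = 1 and b = 0 and c = 0] have "(\<beta> + 1/2) * z - y / 2 = z * \<alpha>" "z / 2 + (\<beta> - 1/2) * y = y * \<alpha>"
    and l: "l = - \<alpha>\<^sup>2 / 2"
    by simp_all
  then have 1: "l = - \<alpha>\<^sup>2 / 2" "(\<alpha> - \<beta>) * z = (z - y) / 2" "(\<alpha> - \<beta>) * y = (z - y) / 2"
    by (simp_all add: field_simps)
  from eq[where a = 0 and b = 1 and c = 0] have 2: "x = \<alpha> / 2 - \<beta>" "\<alpha>\<^sup>2 / 2 - \<alpha> * \<beta> + (\<alpha> / 2 - \<beta>) - l = x"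
    by algebra+
  have "\<alpha>\<^sup>2 / 2 - \<alpha> * \<beta> = l"
    using 2 by linarith
  then have "\<alpha> * (\<alpha> - \<beta>) = 0"
    unfolding l by (simp add: power2_eq_square algebra_simps)
  with 1 2 show "l = - \<alpha>\<^sup>2 / 2 \<and> \<alpha> * (\<alpha> - \<beta>) = 0 \<and>
    x = \<alpha> / 2 - \<beta> \<and> (\<alpha> - \<beta>) * y = (z - y) / 2 \<and> (\<alpha> - \<beta>) * z = (z - y) / 2"
    by blast
next
  assume sol: "l = - \<alpha>\<^sup>2 / 2 \<and> \<alpha> * (\<alpha> - \<beta>) = 0 \<and>
    x = \<alpha> / 2 - \<beta> \<and> (\<alpha> - \<beta>) * y = (z - y) / 2 \<and> (\<alpha> - \<beta>) * z = (z - y) / 2"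
  then have eqs: "l = - (\<alpha> * \<alpha>) / 2" "\<alpha> * \<alpha> = \<alpha> * \<beta>" "x = \<alpha> / 2 - \<beta>"
    "\<alpha> * y = \<beta> * y + z / 2 - y / 2" "\<alpha> * z = \<beta> * z + z / 2 - y / 2"
    by (auto simp: power2_eq_square field_simps)
  \<comment> \<open>The component equations at the three basis vectors, in the shape that
    simplification of the goal produces.\<close>
  then have "- (\<alpha> * \<alpha> / 2) = l" "(\<beta> + 1/2) * z - y / 2 = z * \<alpha>" "z / 2 + (\<beta> - 1/2) * y = y * \<alpha>"
    "\<alpha> * y = y * (\<beta> - 1/2) + z / 2" "- (\<alpha> * z) = y / 2 - z * (\<beta> + 1/2)"
    "\<alpha> * \<alpha> / 2 - \<alpha> * \<beta> + (\<alpha> / 2 - \<beta>) - l = x" "\<alpha> * \<alpha> / 2 - \<alpha> * \<beta> + (\<beta> - \<alpha> / 2) - l = - x"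
    by (simp_all only: ring_distribs mult.commute[of z] mult.commute[of y])
  moreover have "x * (\<beta> + 1/2) - (\<beta> - 1/2) * x = \<alpha> / 2 - \<beta>" "x * (\<beta> - 1/2) - (\<beta> + 1/2) * x = \<beta> - \<alpha> / 2"
    using eqs(3) by (simp_all add: field_simps)
  ultimately show "ricci_soliton br g (vec3 x y z) l"
    unfolding ricci_soliton_vec3
    by (simp add: algebra_II_ricci_op[OF assms] power2_eq_square)
qed

lemma algebra_III_soliton_iff:
  assumes "algebra_III br e1 e2 e3 \<alpha>"
  shows "ricci_soliton br g (vec3 x y z) l \<longleftrightarrow> l = - \<alpha>\<^sup>2 / 2 \<and>
    x = \<alpha> \<and> y = - 1 / sqrt 2 \<and> z = 1 / sqrt 2"
proof -
  \<comment> \<open>With \<open>q * q = 1 / 2\<close> in place of the square root, the soliton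
    equation is a polynomial system that \<open>algebra\<close> can handle.\<close>
  define q where "q = 1 / sqrt 2"
  have q: "q * q = 1 / 2" "q \<noteq> 0" by (simp_all add: q_def)
  have div: "t / sqrt 2 = t * q" for t by (simp add: q_def)
  show ?thesis
  proof
    assume "ricci_soliton br g (vec3 x y z) l"
    then have eq: "Q (vec3 a b c) - l *\<^sub>R vec3 a b c =
      A (cross (vec3 x y z) (vec3 a b c)) - cross (vec3 x y z) (A (vec3 a b c))" for a b c
      unfolding ricci_soliton_br by blast
    note eq = eq[unfolded algebra_III_ricci_op[OF assms] cross_vec3 vec3_arith vec3_inject div]
    from eq[where a = 1 and b = 0 and c = 0] eq[where a = 0 and b = 1 and c = 0] q have h: "x = \<alpha>" "(z - y) * q = 1" "- (\<alpha>\<^sup>2 / 2) - l = 2 * (y + z) * q"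
      "- (\<alpha>\<^sup>2 / 2) - 1 - l = - (2 * z * q)"
      by algebra+
    from h(2-) q have "y = - q" "z = q" by algebra+
    with h(1,3) show "l = - \<alpha>\<^sup>2 / 2 \<and> x = \<alpha> \<and> y = - 1 / sqrt 2 \<and> z = 1 / sqrt 2"
      by (simp add: q_def)
  next
    assume "l = - \<alpha>\<^sup>2 / 2 \<and> x = \<alpha> \<and> y = - 1 / sqrt 2 \<and> z = 1 / sqrt 2"
    then have "l = - \<alpha>\<^sup>2 / 2" "x = \<alpha>" "y = - q" "z = q" by (simp_all add: q_def)
    then show "ricci_soliton br g (vec3 x y z) l"
      unfolding ricci_soliton_vec3 ball_simps algebra_III_ricci_op[OF assms] cross_vec3 vec3_arith vec3_inject div
      using q(1) by (intro conjI TrueI; algebra)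
  qed
qed

end

section \<open>Non-triviality and the complete sets of soliton fields\<close>

context ppm_unimodular
begin

text \<open>An injective \<open>Q\<close> cannot kill the line direction of a product, and a
  trace-free \<open>Q\<close> of a product would vanish, which is Einstein with constant
  zero.\<close>

lemma nontrivialI:
  assumes "\<not> einstein br g" and "lin_trace Q = 0 \<or> (\<forall>u. Q u = 0 \<longrightarrow> u = 0)"
  shows "nontrivial br g"
  unfolding nontrivial_def
proof (intro conjI notI assms(1))
  assume "product_line_surface br g"
  from einstein_or_kernel_if_product[OF this]
  obtain u where "u \<noteq> 0" "Q u = 0" "lin_trace Q = 0 \<longrightarrow> (\<forall>x. Q x = 0)" .
  with assms(2) have "Q x = 0 *\<^sub>R x" for x by auto
  then show False using assms(1) unfolding einstein_br by blast
qed (use assms(1) in blast)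

text \<open>The nilpotent part of \<open>Q\<close> has the nonzero coefficient
  \<open>\<alpha> / 2 - \<beta>\<close>, which excludes Einstein. For \<open>\<alpha> = 0\<close>
  nothing else remains and the trace is zero; for \<open>\<alpha> = \<beta>\<close> the only
  eigenvalue is \<open>- \<beta>\<^sup>2 / 2\<close>, so \<open>Q\<close> is injective.\<close>

lemma algebra_II_nontrivial:
  assumes II: "algebra_II br e1 e2 e3 \<alpha> \<beta>" and "\<alpha> = 0 \<or> \<alpha> = \<beta>" "\<beta> \<noteq> 0"
  shows "nontrivial br g"
proof (rule nontrivialI)
  note Q = algebra_II_ricci_op[OF II]
  show "\<not> einstein br g"
  proof
    assume "einstein br g"
    then obtain c where c: "\<And>x. Q x = c *\<^sub>R x" unfolding einstein_br by blast
    have "\<alpha> / 2 - \<beta> = 0" using c[of "vec3 0 1 0"] by (simp add: Q)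
    then show False using assms(2,3) by auto
  qed
  show "lin_trace Q = 0 \<or> (\<forall>u. Q u = 0 \<longrightarrow> u = 0)"
    using assms(2)
  proof
    assume \<alpha>: "\<alpha> = 0"
    have "lin_trace Q = 0"
      unfolding lin_trace_basis[OF linear_Q]
      using Q(2)[of 1 0 0] Q(2)[of 0 1 0] Q(2)[of 0 0 1] by (simp add: vec3_basis \<alpha> g_simps)
    then show ?thesis ..
  next
    assume \<alpha>: "\<alpha> = \<beta>"
    have "u = 0" if "Q u = 0" for u
    proof -
      obtain x y z where u: "u = vec3 x y z" by (rule vec3_cases)
      have "Q (vec3 x y z) = vec3 0 0 0" using that by (simp add: u vec3_basis)
      then have h: "\<beta>\<^sup>2 * x = 0" "- (\<beta>\<^sup>2 / 2) * y - \<beta> / 2 * (y - z) = 0" "- (\<beta>\<^sup>2 / 2) * z - \<beta> / 2 * (y - z) = 0"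
        unfolding Q \<alpha> by (simp_all add: power2_eq_square)
      then have "\<beta>\<^sup>2 * (y - z) = 0" by (simp add: algebra_simps)
      with h show ?thesis using \<open>\<beta> \<noteq> 0\<close> by (simp add: u vec3_basis)
    qed
    then show ?thesis by blast
  qed
qed

text \<open>Disposes of \<open>\<alpha> = \<beta> = 0\<close>, which the soliton equation still
  permits.\<close>

lemma algebra_II_flat:
  assumes "algebra_II br e1 e2 e3 0 0"
  shows "einstein br g"
proof -
  have "Q x = 0 *\<^sub>R x" for x
    by (rule vec3_cases[of x]) (simp add: algebra_II_ricci_op[OF assms])
  then show ?thesis unfolding einstein_br by blast
qed

lemma algebra_III_nontrivial:
  assumes III: "algebra_III br e1 e2 e3 \<alpha>"
  shows "nontrivial br g"
proof (rule nontrivialI)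
  note Q = algebra_III_ricci_op[OF III]
  show "\<not> einstein br g"
  proof
    assume "einstein br g"
    then obtain c where c: "\<And>x. Q x = c *\<^sub>R x" unfolding einstein_br by blast
    show False using c[of "vec3 0 1 0"] by (simp add: Q)
  qed
  show "lin_trace Q = 0 \<or> (\<forall>u. Q u = 0 \<longrightarrow> u = 0)"
  proof (cases "\<alpha> = 0")
    case True
    have "lin_trace Q = 0"
      unfolding lin_trace_basis[OF linear_Q]
      using Q(2)[of 1 0 0] Q(2)[of 0 1 0] Q(2)[of 0 0 1] by (simp add: vec3_basis True g_simps)
    then show ?thesis ..
  next
    case False
    have "u = 0" if "Q u = 0" for u
    proof -
      obtain x y z where u: "u = vec3 x y z" by (rule vec3_cases)
      define k where "k = \<alpha> / sqrt 2"
      have "Q (vec3 x y z) = vec3 0 0 0" using that by (simp add: u vec3_basis)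
      then have h: "- \<alpha>\<^sup>2 / 2 * x - k * (y + z) = 0" "- \<alpha>\<^sup>2 / 2 * y - k * x - (y + z) = 0"
          "- \<alpha>\<^sup>2 / 2 * z + k * x + (y + z) = 0"
        unfolding Q k_def by simp_all
      have "- \<alpha>\<^sup>2 / 2 * (y + z) = 0"
        using h(2,3) by (simp add: algebra_simps)
      then have yz: "y + z = 0" using False by simp
      with h(1) have "x = 0" using False by simp
      with h(2,3) yz have "y = 0" "z = 0" using False by auto
      with \<open>x = 0\<close> show ?thesis by (simp add: u vec3_basis)
    qed
    then show ?thesis by blast
  qed
qed

lemma lorentzian_g: "lorentzian g"
  using symmetric_g onb unfolding lorentzian_def by blast

lemma algebra_II_steady_iff:
  assumes "algebra_II br e1 e2 e3 0 \<beta>" "\<beta> \<noteq> 0"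
  shows "ricci_soliton br g X l \<longleftrightarrow> l = 0 \<and> X = - (\<beta> *\<^sub>R e1)"
proof -
  obtain x y z where X: "X = vec3 x y z" by (rule vec3_cases)
  have "- (\<beta> *\<^sub>R e1) = vec3 (- \<beta>) 0 0" by (simp add: vec3_def)
  moreover have "- (\<beta> * y) = (z - y) / 2 \<and> - (\<beta> * z) = (z - y) / 2 \<longleftrightarrow> y = 0 \<and> z = 0"
  proof
    assume h: "- (\<beta> * y) = (z - y) / 2 \<and> - (\<beta> * z) = (z - y) / 2"
    then have "\<beta> * y = \<beta> * z" by linarith
    with h assms(2) show "y = 0 \<and> z = 0" by simp
  qed simp
  ultimately show ?thesis
    unfolding X by (auto simp: algebra_II_soliton_iff[OF assms(1)])
qed

text \<open>For \<open>\<alpha> = \<beta>\<close> both conditions on \<open>y\<close> and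
  \<open>z\<close> reduce to \<open>y = z\<close>; this common value is the free parameter.\<close>

lemma algebra_II_expanding_iff:
  assumes "algebra_II br e1 e2 e3 \<beta> \<beta>"
  shows "ricci_soliton br g X l \<longleftrightarrow>
    l = - \<beta>\<^sup>2 / 2 \<and> (\<exists>\<delta>. X = - ((1/2 * \<beta>) *\<^sub>R e1) + \<delta> *\<^sub>R e2 + \<delta> *\<^sub>R e3)"
proof -
  obtain x y z where X: "X = vec3 x y z" by (rule vec3_cases)
  have "- ((1/2 * \<beta>) *\<^sub>R e1) + \<delta> *\<^sub>R e2 + \<delta> *\<^sub>R e3 = vec3 (- \<beta> / 2) \<delta> \<delta>" for \<delta>
    by (simp add: vec3_def)
  then show ?thesis
    unfolding X by (auto simp: algebra_II_soliton_iff[OF assms(1)])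
qed

lemma algebra_III_field:
  "\<alpha> *\<^sub>R e1 - (1 / sqrt 2) *\<^sub>R e2 + (1 / sqrt 2) *\<^sub>R e3 = vec3 \<alpha> (- 1 / sqrt 2) (1 / sqrt 2)"
  by (simp add: vec3_def)

lemma algebra_III_iff:
  assumes "algebra_III br e1 e2 e3 \<alpha>"
  shows "ricci_soliton br g X l \<longleftrightarrow>
    l = - \<alpha>\<^sup>2 / 2 \<and> X = \<alpha> *\<^sub>R e1 - (1 / sqrt 2) *\<^sub>R e2 + (1 / sqrt 2) *\<^sub>R e3"
  unfolding algebra_III_field
  by (rule vec3_cases[of X]) (auto simp: algebra_III_soliton_iff[OF assms])

end

section \<open>Classification\<close>

text \<open>In type II the condition \<open>\<alpha> * (\<alpha> - \<beta>) = 0\<close> yields the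
  first two families, with \<open>\<beta> = 0\<close> excluded as Einstein; type III splits
  according to whether \<open>\<alpha>\<close> vanishes.\<close>

lemma soliton_classification:
  fixes br :: "'a::euclidean_space \<Rightarrow> 'a \<Rightarrow> 'a" and g :: "'a \<Rightarrow> 'a \<Rightarrow> real"
  assumes dim: "DIM('a) = 3" and br: "bilinear br" "\<forall>x. br x x = 0" "unimodular br"
    and g: "lorentzian g" and ne: "\<not> einstein br g" and sol: "ricci_soliton br g X l"
  shows "\<exists>e1 e2 e3. orthonormal_basis_ppm g e1 e2 e3 \<and>
           ((\<exists>\<beta>. \<beta> \<noteq> 0 \<and> algebra_II br e1 e2 e3 0 \<beta> \<and> X = - (\<beta> *\<^sub>R e1)) \<or>
            (\<exists>\<beta> \<delta>. \<beta> \<noteq> 0 \<and> algebra_II br e1 e2 e3 \<beta> \<beta> \<and>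
               X = - ((1/2 * \<beta>) *\<^sub>R e1) + \<delta> *\<^sub>R e2 + \<delta> *\<^sub>R e3) \<or>
            (\<exists>\<alpha>. \<alpha> \<noteq> 0 \<and> algebra_III br e1 e2 e3 \<alpha> \<and>
               X = \<alpha> *\<^sub>R e1 - (1 / sqrt 2) *\<^sub>R e2 + (1 / sqrt 2) *\<^sub>R e3) \<or>
            (algebra_III br e1 e2 e3 0 \<and>
               X = - ((1 / sqrt 2) *\<^sub>R e2) + (1 / sqrt 2) *\<^sub>R e3))"
proof -
  have sym: "symmetric_form g" using g by (simp add: lorentzian_def)
  have frame: "ppm_unimodular g f1 f2 f3 br" if "orthonormal_basis_ppm g f1 f2 f3" for f1 f2 f3
    by unfold_locales (use that sym br in auto)
  obtain b1 b2 b3 where "orthonormal_basis_ppm g b1 b2 b3"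
    using g by (auto simp: lorentzian_def)
  from dim frame[OF this] sol ne show ?thesis
  proof (cases rule: soliton_normal_form)
    case (1 e1 e2 e3 \<alpha> \<beta>)
    interpret ppm_unimodular g e1 e2 e3 br by (rule frame) fact
    obtain x y z where X: "X = vec3 x y z" by (rule vec3_cases)
    have \<alpha>: "\<alpha> = 0 \<or> \<alpha> = \<beta>"
      using sol unfolding X algebra_II_soliton_iff[OF 1(2)] by auto
    have "\<beta> \<noteq> 0"
    proof
      assume "\<beta> = 0"
      with \<alpha> 1(2) ne show False using algebra_II_flat by blast
    qed
    from \<alpha> show ?thesis
    proof
      assume "\<alpha> = 0"
      with 1 sol \<open>\<beta> \<noteq> 0\<close> show ?thesis using algebra_II_steady_iff by blast
    next
      assume "\<alpha> = \<beta>"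
      with 1 sol \<open>\<beta> \<noteq> 0\<close> show ?thesis using algebra_II_expanding_iff by blast
    qed
  next
    case (2 e1 e2 e3 \<alpha>)
    interpret ppm_unimodular g e1 e2 e3 br by (rule frame) fact
    have X: "X = \<alpha> *\<^sub>R e1 - (1 / sqrt 2) *\<^sub>R e2 + (1 / sqrt 2) *\<^sub>R e3"
      using sol algebra_III_iff[OF 2(2)] by blast
    show ?thesis
    proof (cases "\<alpha> = 0")
      case True
      with X have "X = - ((1 / sqrt 2) *\<^sub>R e2) + (1 / sqrt 2) *\<^sub>R e3" by simp
      with True 2 show ?thesis by blast
    next
      case False
      with X 2 show ?thesis by blast
    qed
  qed
qed

theorem theorem5:
  fixes br :: "'a::euclidean_space \<Rightarrow> 'a \<Rightarrow> 'a" and g :: "'a \<Rightarrow> 'a \<Rightarrow> real"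
  assumes "DIM('a) = 3"
    and "bilinear br" and "\<forall>x. br x x = 0"
    and "symmetric_form g"
  shows
    "(lie_bracket br \<and> unimodular br \<and> lorentzian g \<and> nontrivial br g \<longrightarrow>
       (\<forall>X l. ricci_soliton br g X l \<longrightarrow>
         (\<exists>e1 e2 e3. orthonormal_basis_ppm g e1 e2 e3 \<and>
           ((\<exists>\<beta>. \<beta> \<noteq> 0 \<and> algebra_II br e1 e2 e3 0 \<beta> \<and> X = - (\<beta> *\<^sub>R e1)) \<or>
            (\<exists>\<beta> \<delta>. \<beta> \<noteq> 0 \<and> algebra_II br e1 e2 e3 \<beta> \<beta> \<and>
               X = - ((1/2 * \<beta>) *\<^sub>R e1) + \<delta> *\<^sub>R e2 + \<delta> *\<^sub>R e3) \<or>
            (\<exists>\<alpha>. \<alpha> \<noteq> 0 \<and> algebra_III br e1 e2 e3 \<alpha> \<and>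
               X = \<alpha> *\<^sub>R e1 - (1 / sqrt 2) *\<^sub>R e2 + (1 / sqrt 2) *\<^sub>R e3) \<or>
            (algebra_III br e1 e2 e3 0 \<and>
               X = - ((1 / sqrt 2) *\<^sub>R e2) + (1 / sqrt 2) *\<^sub>R e3)))))
     \<and>
     (\<forall>e1 e2 e3. orthonormal_basis_ppm g e1 e2 e3 \<longrightarrow>
       (\<forall>\<beta>. \<beta> \<noteq> 0 \<and> algebra_II br e1 e2 e3 0 \<beta> \<longrightarrow>
          lie_bracket br \<and> unimodular br \<and> lorentzian g \<and> nontrivial br g \<and>
          iso_matrix_lie_algebra br e11 \<and>
          (\<forall>X. (\<exists>l. ricci_soliton br g X l) \<longleftrightarrow> X = - (\<beta> *\<^sub>R e1)) \<and>
          (\<forall>X. X = - (\<beta> *\<^sub>R e1) \<longrightarrow> steady_soliton br g X \<and> spacelike g X)) \<and>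
       (\<forall>\<beta>. \<beta> \<noteq> 0 \<and> algebra_II br e1 e2 e3 \<beta> \<beta> \<longrightarrow>
          lie_bracket br \<and> unimodular br \<and> lorentzian g \<and> nontrivial br g \<and>
          (iso_matrix_lie_algebra br o12 \<or> iso_matrix_lie_algebra br sl2) \<and>
          (\<forall>X. (\<exists>l. ricci_soliton br g X l) \<longleftrightarrow>
             (\<exists>\<delta>. X = - ((1/2 * \<beta>) *\<^sub>R e1) + \<delta> *\<^sub>R e2 + \<delta> *\<^sub>R e3)) \<and>
          (\<forall>X \<delta>. X = - ((1/2 * \<beta>) *\<^sub>R e1) + \<delta> *\<^sub>R e2 + \<delta> *\<^sub>R e3 \<longrightarrow>
             expanding_soliton br g X \<and> spacelike g X)) \<and>
       (\<forall>\<alpha>. \<alpha> \<noteq> 0 \<and> algebra_III br e1 e2 e3 \<alpha> \<longrightarrow>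
          lie_bracket br \<and> unimodular br \<and> lorentzian g \<and> nontrivial br g \<and>
          (iso_matrix_lie_algebra br o12 \<or> iso_matrix_lie_algebra br sl2) \<and>
          (\<forall>X. (\<exists>l. ricci_soliton br g X l) \<longleftrightarrow>
             X = \<alpha> *\<^sub>R e1 - (1 / sqrt 2) *\<^sub>R e2 + (1 / sqrt 2) *\<^sub>R e3) \<and>
          (\<forall>X. X = \<alpha> *\<^sub>R e1 - (1 / sqrt 2) *\<^sub>R e2 + (1 / sqrt 2) *\<^sub>R e3 \<longrightarrow>
             expanding_soliton br g X \<and> spacelike g X)) \<and>
       (algebra_III br e1 e2 e3 0 \<longrightarrow>
          lie_bracket br \<and> unimodular br \<and> lorentzian g \<and> nontrivial br g \<and>
          iso_matrix_lie_algebra br e11 \<and>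
          (\<forall>X. (\<exists>l. ricci_soliton br g X l) \<longleftrightarrow>
             X = - ((1 / sqrt 2) *\<^sub>R e2) + (1 / sqrt 2) *\<^sub>R e3) \<and>
          (\<forall>X. X = - ((1 / sqrt 2) *\<^sub>R e2) + (1 / sqrt 2) *\<^sub>R e3 \<longrightarrow>
             steady_soliton br g X \<and> null_vector g X)))"
proof -
  \<comment> \<open>For the converse neither unimodularity nor the Jacobi identity is given: the
    first is read off the brackets, and the second then follows from it.\<close>
  have frame: "ppm_lie_algebra g e1 e2 e3 br" if "orthonormal_basis_ppm g e1 e2 e3" for e1 e2 e3
    by unfold_locales (use that assms in auto)
  have a: "lie_bracket br \<and> unimodular br \<and> lorentzian g \<and> nontrivial br g \<and>
      iso_matrix_lie_algebra br e11 \<and>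
      (\<forall>X. (\<exists>l. ricci_soliton br g X l) \<longleftrightarrow> X = - (\<beta> *\<^sub>R e1)) \<and>
      (\<forall>X. X = - (\<beta> *\<^sub>R e1) \<longrightarrow> steady_soliton br g X \<and> spacelike g X)"
    if onb: "orthonormal_basis_ppm g e1 e2 e3" and \<beta>: "\<beta> \<noteq> 0" "algebra_II br e1 e2 e3 0 \<beta>"
    for e1 e2 e3 \<beta>
  proof -
    interpret ppm_lie_algebra g e1 e2 e3 br by (rule frame) fact
    interpret ppm_unimodular g e1 e2 e3 br by (rule algebra_II_unimodular) fact
    have "g (- (\<beta> *\<^sub>R e1)) (- (\<beta> *\<^sub>R e1)) > 0"
      using \<beta>(1) by (simp add: g_simps zero_less_mult_iff) arith
    then show ?thesis
      using lie_bracket_br unimodular_br lorentzian_g algebra_II_nontrivial[OF \<beta>(2) _ \<beta>(1)]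
        algebra_II_iso_e11[OF \<beta>(2,1)] algebra_II_steady_iff[OF \<beta>(2,1)]
      by (simp add: steady_soliton_def spacelike_def)
  qed
  have b: "lie_bracket br \<and> unimodular br \<and> lorentzian g \<and> nontrivial br g \<and>
      (iso_matrix_lie_algebra br o12 \<or> iso_matrix_lie_algebra br sl2) \<and>
      (\<forall>X. (\<exists>l. ricci_soliton br g X l) \<longleftrightarrow>
         (\<exists>\<delta>. X = - ((1/2 * \<beta>) *\<^sub>R e1) + \<delta> *\<^sub>R e2 + \<delta> *\<^sub>R e3)) \<and>
      (\<forall>X \<delta>. X = - ((1/2 * \<beta>) *\<^sub>R e1) + \<delta> *\<^sub>R e2 + \<delta> *\<^sub>R e3 \<longrightarrow>
         expanding_soliton br g X \<and> spacelike g X)"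
    if onb: "orthonormal_basis_ppm g e1 e2 e3" and \<beta>: "\<beta> \<noteq> 0" "algebra_II br e1 e2 e3 \<beta> \<beta>"
    for e1 e2 e3 \<beta>
  proof -
    interpret ppm_lie_algebra g e1 e2 e3 br by (rule frame) fact
    interpret ppm_unimodular g e1 e2 e3 br by (rule algebra_II_unimodular) fact
    let ?X = "\<lambda>\<delta>. - ((1/2 * \<beta>) *\<^sub>R e1) + \<delta> *\<^sub>R e2 + \<delta> *\<^sub>R e3"
    have iff: "ricci_soliton br g X l \<longleftrightarrow> l = - \<beta>\<^sup>2 / 2 \<and> (\<exists>\<delta>. X = ?X \<delta>)" for X l
      by (rule algebra_II_expanding_iff) fact
    have "spacelike g (?X \<delta>)" for \<delta>
    proof -
      have "?X \<delta> = vec3 (- \<beta> / 2) \<delta> \<delta>" by (simp add: vec3_def)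
      moreover have "\<beta> * \<beta> > 0" using \<beta>(1) by (simp add: zero_less_mult_iff) arith
      ultimately show ?thesis by (simp add: spacelike_def)
    qed
    moreover have "expanding_soliton br g (?X \<delta>)" for \<delta>
      unfolding expanding_soliton_def iff using \<beta>(1) by (intro exI[of _ "- \<beta>\<^sup>2 / 2"]) auto
    moreover have "(\<exists>l. ricci_soliton br g X l) \<longleftrightarrow> (\<exists>\<delta>. X = ?X \<delta>)" for X
      unfolding iff by blast
    \<comment> \<open>Of the two alternatives \<open>o12\<close> and \<open>sl2\<close>, the second
      is the one established.\<close>
    ultimately show ?thesis
      using lie_bracket_br unimodular_br lorentzian_g algebra_II_nontrivial[OF \<beta>(2) _ \<beta>(1)]
        algebra_II_iso_sl2[OF \<beta>(2,1)] by blast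
  qed
  have c: "lie_bracket br \<and> unimodular br \<and> lorentzian g \<and> nontrivial br g \<and>
      (iso_matrix_lie_algebra br o12 \<or> iso_matrix_lie_algebra br sl2) \<and>
      (\<forall>X. (\<exists>l. ricci_soliton br g X l) \<longleftrightarrow>
         X = \<alpha> *\<^sub>R e1 - (1 / sqrt 2) *\<^sub>R e2 + (1 / sqrt 2) *\<^sub>R e3) \<and>
      (\<forall>X. X = \<alpha> *\<^sub>R e1 - (1 / sqrt 2) *\<^sub>R e2 + (1 / sqrt 2) *\<^sub>R e3 \<longrightarrow>
         expanding_soliton br g X \<and> spacelike g X)"
    if onb: "orthonormal_basis_ppm g e1 e2 e3" and \<alpha>: "\<alpha> \<noteq> 0" "algebra_III br e1 e2 e3 \<alpha>"
    for e1 e2 e3 \<alpha>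
  proof -
    interpret ppm_lie_algebra g e1 e2 e3 br by (rule frame) fact
    interpret ppm_unimodular g e1 e2 e3 br by (rule algebra_III_unimodular) fact
    let ?X = "\<alpha> *\<^sub>R e1 - (1 / sqrt 2) *\<^sub>R e2 + (1 / sqrt 2) *\<^sub>R e3"
    have iff: "ricci_soliton br g X l \<longleftrightarrow> l = - \<alpha>\<^sup>2 / 2 \<and> X = ?X" for X l
      by (rule algebra_III_iff) fact
    have "\<alpha> * \<alpha> > 0" using \<alpha>(1) by (simp add: zero_less_mult_iff) arith
    then have "spacelike g ?X"
      unfolding algebra_III_field by (simp add: spacelike_def)
    moreover have "expanding_soliton br g ?X"
      unfolding expanding_soliton_def iff using \<alpha>(1) by (intro exI[of _ "- \<alpha>\<^sup>2 / 2"]) auto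
    moreover have "(\<exists>l. ricci_soliton br g X l) \<longleftrightarrow> X = ?X" for X
      unfolding iff by blast
    ultimately show ?thesis
      using lie_bracket_br unimodular_br lorentzian_g algebra_III_nontrivial[OF \<alpha>(2)]
        algebra_III_iso_sl2[OF \<alpha>(2,1)] by blast
  qed
  have d: "lie_bracket br \<and> unimodular br \<and> lorentzian g \<and> nontrivial br g \<and>
      iso_matrix_lie_algebra br e11 \<and>
      (\<forall>X. (\<exists>l. ricci_soliton br g X l) \<longleftrightarrow>
         X = - ((1 / sqrt 2) *\<^sub>R e2) + (1 / sqrt 2) *\<^sub>R e3) \<and>
      (\<forall>X. X = - ((1 / sqrt 2) *\<^sub>R e2) + (1 / sqrt 2) *\<^sub>R e3 \<longrightarrow>
         steady_soliton br g X \<and> null_vector g X)"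
    if onb: "orthonormal_basis_ppm g e1 e2 e3" and III: "algebra_III br e1 e2 e3 0"
    for e1 e2 e3
  proof -
    interpret ppm_lie_algebra g e1 e2 e3 br by (rule frame) fact
    interpret ppm_unimodular g e1 e2 e3 br by (rule algebra_III_unimodular) fact
    let ?X = "- ((1 / sqrt 2) *\<^sub>R e2) + (1 / sqrt 2) *\<^sub>R e3"
    have iff: "ricci_soliton br g X l \<longleftrightarrow> l = 0 \<and> X = ?X" for X l
      using algebra_III_iff[OF III] by simp
    have "?X = vec3 0 (- 1 / sqrt 2) (1 / sqrt 2)" by (simp add: vec3_def)
    then have "null_vector g ?X"
      by (simp add: null_vector_def flip: vec3_basis(4))
    moreover have "steady_soliton br g ?X"
      unfolding steady_soliton_def iff by blast
    moreover have "(\<exists>l. ricci_soliton br g X l) \<longleftrightarrow> X = ?X" for X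
      unfolding iff by blast
    ultimately show ?thesis
      using lie_bracket_br unimodular_br lorentzian_g algebra_III_nontrivial[OF III]
        algebra_III_iso_e11[OF III] by blast
  qed
  show ?thesis
  proof (rule conjI, goal_cases)
    case 1
    show ?case
      by (intro impI allI, elim conjE, rule soliton_classification[OF assms(1-3)])
        (simp_all add: nontrivial_def)
  next
    case 2
    show ?case
      by (intro allI impI, rule conjI[OF _ conjI[OF _ conjI]];
        (intro allI impI)?, (elim conjE)?, (rule a b c d; assumption))
  qed
qed

end
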